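(* Let $f\in\mathcal{F}_{\mathbb{N}}$ be a decorated identity among quantum minors, let $k\neq k'$ be row labels, and let $l_0$ be a column label, such that the following three conditions hold. 1) (Linearity) In each monomial of $f$, all factors are of the form $\Delta^K_L(0)$ except one. That one exceptional factor is $f^k_l(1)=\Delta^{\{k\}}_{\{l\}}(1)$ for some column label $l\neq l_0$, and it appears exactly once in the monomial. The label $l$ may depend on the monomial (the label $k$ does not). 2) (Included row condition) In each monomial of $f$, each factor of the form $\Delta^K_L(0)$ satisfies $k,k'\in K$ and $l_0\in L$. 3) (Hierarchy of identities) The element $f^\vee\in\mathcal{F}_{\mathbb{N}}$, obtained from $f$ by erasing the row label $k'$ and the column label $l_0$ from each factor of the form $\Delta^K_L(0)$, i.e. by replacing each factor $\Delta^K_L(0)$ in each monomial of $f$ by $\Delta^{K\setminus\{k'\}}_{L\setminus\{l_0\}}(0)$ (coefficients, order of factors, and the factors $f^k_l(1)$ being left unchanged), is a decorated identity. Then the replacement rule $A=(A_1)=((k\to k'))$ injectively matches $f$, and $\phi_A(f)$ is a decorated identity among quantum minors.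
   Context: Let $\mathbf{k}$ be the base field and $0\neq q\in\mathbf{k}$. Fix linearly ordered nonempty sets of row labels and of column labels (finite, or countably infinite). The algebra $\mathcal{M}_q$ (the quantum linear semigroup on these labels) is the associative unital $\mathbf{k}$-algebra with generators $t^\alpha_\gamma$ ($\alpha$ a row label, $\gamma$ a column label) and relations - $t^\alpha_\gamma t^\alpha_\delta = q\, t^\alpha_\delta t^\alpha_\gamma$ for $\gamma<\delta$; - $t^\alpha_\gamma t^\beta_\gamma = q\, t^\beta_\gamma t^\alpha_\gamma$ for $\alpha<\beta$; - $[t^\alpha_\gamma,t^\beta_\delta]=(q-q^{-1})\,t^\beta_\gamma t^\alpha_\delta\,(\theta(\delta>\gamma)-\theta(\alpha>\beta))$ for $\alpha\neq\beta$ and $\gamma\neq\delta$, where $\theta(\text{true})=1$, $\theta(\text{false})=0$, and $[\,,]$ is the ordinary commutator. Multilabels: for finite sets $K$ of row labels and $L$ of column labels with $|K|=|L|=m\geq 1$, the quantum minor is $$D^K_L=\sum_{\sigma\in\Sigma(m)}(-q)^{l(\sigma)}\,t^{c_K(1)}_{c_L(\sigma(1))}\cdots t^{c_K(m)}_{c_L(\sigma(m))}\in\mathcal{M}_q,$$ where $\Sigma(m)$ is the symmetric group, $l(\sigma)$ is the number of inversions of $\sigma$, and $c_K,c_L$ are the unique strictly increasing bijections from $\{1,\dots,m\}$ onto $K$ and $L$. In particular $D^{\{k\}}_{\{l\}}=t^k_l$. Free algebras: $\mathcal{F}$ is the free associative unital $\mathbf{k}$-algebra on symbols $\Delta^K_L$,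 where $K,L$ are multilabels with $|K|=|L|$, and $\pi:\mathcal{F}\to\mathcal{M}_q$ is the algebra homomorphism with $\pi(\Delta^K_L)=D^K_L$. $\mathcal{F}_{\mathbb{N}}$ is the free associative unital $\mathbf{k}$-algebra on decorated symbols $\Delta^K_L(i)$, $i=0,1,2,\dots$ ($K,L$ as before), and $\pi_{\mathbb{N}}:\mathcal{F}_{\mathbb{N}}\to\mathcal{F}$ is the algebra homomorphism $\Delta^K_L(i)\mapsto\Delta^K_L$ for all $i$. Write $f^k_l(i):=\Delta^{\{k\}}_{\{l\}}(i)$. A decorated identity among quantum minors is an element $f\in\mathcal{F}_{\mathbb{N}}$ such that $\pi(\pi_{\mathbb{N}}(f))=0$. The monomials of $f$ are the noncommutative words in the symbols $\Delta^K_L(i)$ occurring in $f$ with nonzero coefficient. Replacement rule: for row labels $k\neq k'$ and the one-term sequence $A=(A_1)=((k\to k'))$ (the rule $A_1$ acts on symbols decorated by $1$; no replacement of column labels), $\phi_A$ is the unique algebra endomorphism of $\mathcal{F}_{\mathbb{N}}$ that sends $\Delta^I_J(1)$ to $\Delta^{(I\setminus\{k\})\cup\{k'\}}_J(1)$ whenever $k\in I$ and $k'\notin I$, and fixes all other generators (in particular every $\Delta^I_J(i)$ with $i\neq 1$). Thus $\phi_A(f^k_l(1))=f^{k'}_l(1)$. The element $f\in\mathcal{F}_{\mathbb{N}}$ is an injective match for $A$ (equivalently, $A$ injectively matches $f$) if each monomial of $f$ has exactly one factor of the form $\Delta^I_J(1)$ with $k\in I$, and that factor appears exactly once in the monomial.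 *)

theory Defs
  imports
    "HOL-Library.Poly_Mapping"
    "HOL-Library.Countable"
    "HOL-Combinatorics.Permutations"
    "HOL-Algebra.QuotRing"
    "HOL-Algebra.Algebraic_Closure_Type"
begin

section \<open>Free associative algebras\<close>

text \<open>
  Words over an alphabet are lists, seen as an additively written monoid. The monoid algebra
  \<open>'x list \<Rightarrow>\<^sub>0 'k\<close> is then the free associative unital algebra on \<open>'x\<close>, with the convolution
  product of \<^theory>\<open>HOL-Library.Poly_Mapping\<close>, and \<^const>\<open>Poly_Mapping.keys\<close> gives the monomials that
  occur with nonzero coefficient.
\<close>

instantiation list :: (type) monoid_add
begin
definition zero_list_def: "(0 :: 'a list) = []"
definition plus_list_def: "(xs :: 'a list) + ys = xs @ ys"
instance by standard (simp_all add: zero_list_def plus_list_def)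
end

type_synonym ('x, 'k) free_alg = "'x list \<Rightarrow>\<^sub>0 'k"

definition gen :: "'x \<Rightarrow> ('x, 'k::field) free_alg" where
  "gen x = Poly_Mapping.single [x] 1"

definition scalar :: "'k::field \<Rightarrow> ('x, 'k) free_alg" where
  "scalar c = Poly_Mapping.single [] c"

text \<open>The algebra homomorphism extending a map on generators.\<close>

definition free_hom :: "('x \<Rightarrow> ('y, 'k::field) free_alg) \<Rightarrow> ('x, 'k) free_alg \<Rightarrow> ('y, 'k) free_alg" where
  "free_hom g f = (\<Sum>w\<in>Poly_Mapping.keys f. scalar (Poly_Mapping.lookup f w) * prod_list (map g w))"

lemma scalar_simps:
  "scalar 0 = 0" "scalar 1 = 1" "scalar (a + b) = scalar a + scalar b"
  "scalar (a * b) = scalar a * scalar b"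
  by (simp_all add: scalar_def single_add mult_single flip: zero_list_def)

lemma scalar_commute: "scalar c * f = f * (scalar c :: ('x, 'k::field) free_alg)"
proof (induction f rule: update_induct)
  case const
  show ?case by simp
next
  case (update f w b)
  have "Poly_Mapping.update w b f = f + Poly_Mapping.single w b"
    using update(1) by (intro poly_mapping_eqI)
      (auto simp: lookup_update lookup_add lookup_single in_keys_iff when_def)
  then show ?case
    using update by (simp add: algebra_simps scalar_def mult_single plus_list_def)
qed

lemma free_hom_superset:
  assumes "finite S" "Poly_Mapping.keys f \<subseteq> S"
  shows "free_hom g f = (\<Sum>w\<in>S. scalar (Poly_Mapping.lookup f w) * prod_list (map g w))"
  unfolding free_hom_def using assms
  by (intro sum.mono_neutral_left) (auto simp: in_keys_iff scalar_simps)

lemma free_hom_single: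
  "free_hom g (Poly_Mapping.single w c) = scalar c * prod_list (map g w)"
  by (cases "c = 0") (simp_all add: free_hom_def scalar_simps)

lemma free_hom_gen [simp]: "free_hom g (gen x) = g x"
  by (simp add: gen_def free_hom_single scalar_simps)

lemma free_hom_scalar [simp]: "free_hom g (scalar c) = scalar c"
  unfolding scalar_def free_hom_single by (simp add: scalar_def)

lemma free_hom_one [simp]: "free_hom g 1 = 1"
  using free_hom_scalar[of g 1] by (simp add: scalar_simps)

lemma free_hom_add [simp]: "free_hom g (e + f) = free_hom g e + free_hom g f"
proof -
  let ?S = "Poly_Mapping.keys e \<union> Poly_Mapping.keys f"
  have "free_hom g h = (\<Sum>w\<in>?S. scalar (Poly_Mapping.lookup h w) * prod_list (map g w))"
    if "h \<in> {e, f, e + f}" for h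
    using that Poly_Mapping.keys_add[of e f] by (intro free_hom_superset) auto
  then show ?thesis
    by (simp add: lookup_add scalar_simps distrib_right sum.distrib)
qed

lemma free_hom_mult [simp]:
  fixes g :: "'x \<Rightarrow> ('y, 'k::field) free_alg"
  shows "free_hom g (e * f) = free_hom g e * free_hom g f"
proof (induction e rule: update_induct)
  case const
  show ?case by (simp add: free_hom_def)
next
  case (update e v a)
  have *: "Poly_Mapping.update w b h = h + Poly_Mapping.single w b" if "w \<notin> Poly_Mapping.keys h"
    for w :: "'x list" and b :: 'k and h
    using that by (intro poly_mapping_eqI)
      (auto simp: lookup_update lookup_add lookup_single in_keys_iff when_def)
  have "free_hom g (Poly_Mapping.single v a * f) = free_hom g (Poly_Mapping.single v a) * free_hom g f"
  proof (induction f rule: update_induct)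
    case const
    show ?case by (simp add: free_hom_def)
  next
    case (update f w b)
    let ?V = "prod_list (map g v)" and ?W = "prod_list (map g w)"
    have "scalar (a * b) * (?V * ?W) = scalar a * (scalar b * ?V) * ?W"
      by (simp only: scalar_simps mult.assoc)
    also have "\<dots> = scalar a * (?V * scalar b) * ?W"
      by (simp only: scalar_commute[of b ?V])
    also have "\<dots> = (scalar a * ?V) * (scalar b * ?W)"
      by (simp only: mult.assoc)
    finally have "free_hom g (Poly_Mapping.single v a * Poly_Mapping.single w b)
        = free_hom g (Poly_Mapping.single v a) * free_hom g (Poly_Mapping.single w b)"
      by (simp only: mult_single plus_list_def free_hom_single map_append prod_list.append)
    then show ?case
      unfolding *[OF update(1)] distrib_left free_hom_add update(3) by (rule arg_cong)
  qed
  then show ?case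
    unfolding *[OF update(1)] distrib_right free_hom_add update(3) by (rule arg_cong)
qed


section \<open>The quantum linear semigroup\<close>

text \<open>
  Row and column labels are the elements of countable linearly ordered types. The generator
  \<open>t\<^sup>\<alpha>\<^sub>\<gamma>\<close> has row label \<open>\<alpha>\<close> and column label \<open>\<gamma>\<close>.
\<close>

abbreviation t :: "'r \<Rightarrow> 'c \<Rightarrow> ('r \<times> 'c, 'k::field) free_alg" where
  "t \<alpha> \<gamma> \<equiv> gen (\<alpha>, \<gamma>)"

definition q_relators :: "'k::field \<Rightarrow> ('r::linorder \<times> 'c::linorder, 'k) free_alg set" where
  "q_relators q =
     {t \<alpha> \<gamma> * t \<alpha> \<delta> - scalar q * t \<alpha> \<delta> * t \<alpha> \<gamma> | \<alpha> \<gamma> \<delta>. \<gamma> < \<delta>} \<union>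
     {t \<alpha> \<gamma> * t \<beta> \<gamma> - scalar q * t \<beta> \<gamma> * t \<alpha> \<gamma> | \<alpha> \<beta> \<gamma>. \<alpha> < \<beta>} \<union>
     {(t \<alpha> \<gamma> * t \<beta> \<delta> - t \<beta> \<delta> * t \<alpha> \<gamma>)
        - scalar ((q - inverse q) * (of_bool (\<delta> > \<gamma>) - of_bool (\<alpha> > \<beta>))) * t \<beta> \<gamma> * t \<alpha> \<delta>
      | \<alpha> \<beta> \<gamma> \<delta>. \<alpha> \<noteq> \<beta> \<and> \<gamma> \<noteq> \<delta>}"

text \<open>
  \<^const>\<open>genideal\<close> is the generated two-sided ideal (also stable under scalars, since these
  are ring elements of the free algebra).
\<close>

definition q_ideal :: "'k::field \<Rightarrow> ('r::linorder \<times> 'c::linorder, 'k) free_alg set" where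
  "q_ideal q = genideal ring_of_type_algebra (q_relators q)"

definition M_q :: "'k::field \<Rightarrow> ('r::linorder \<times> 'c::linorder, 'k) free_alg set ring" where
  "M_q q = ring_of_type_algebra Quot q_ideal q"

definition q_class :: "'k::field \<Rightarrow> ('r::linorder \<times> 'c::linorder, 'k) free_alg
    \<Rightarrow> ('r \<times> 'c, 'k) free_alg set" where
  "q_class q a = q_ideal q +>\<^bsub>ring_of_type_algebra\<^esub> a"

lemma ring_ring_of_type_algebra: "ring (ring_of_type_algebra :: 'a::ring_1 ring)"
proof -
  have "\<exists>y. x + y = 0" "\<exists>y. y + x = 0" for x :: 'a
    using add.right_inverse add.left_inverse by blast+
  then show ?thesis
    unfolding ring_of_type_algebra_def
    by unfold_locales (auto simp: algebra_simps Units_def)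
qed

lemma ideal_q_ideal: "ideal (q_ideal q) ring_of_type_algebra"
  unfolding q_ideal_def
  by (rule ring.genideal_ideal[OF ring_ring_of_type_algebra]) (simp add: ring_of_type_algebra_def)

lemma ring_M_q: "ring (M_q q)"
  unfolding M_q_def by (rule ideal.quotient_is_ring[OF ideal_q_ideal])

lemma q_class_hom: "q_class q \<in> ring_hom ring_of_type_algebra (M_q q)"
  unfolding M_q_def q_class_def[abs_def] by (rule ideal.rcos_ring_hom[OF ideal_q_ideal])


section \<open>Quantum minors\<close>

text \<open>The symbols \<open>\<Delta>\<^sup>K\<^sub>L\<close>: pairs of multilabels of equal size.\<close>

typedef ('r, 'c) symb =
  "{(K :: 'r set, L :: 'c set). finite K \<and> finite L \<and> card K = card L \<and> card K \<ge> 1}"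
  by (rule exI[of _ "({undefined}, {undefined})"]) simp

definition rows :: "('r, 'c) symb \<Rightarrow> 'r set" where
  "rows s = fst (Rep_symb s)"

definition cols :: "('r, 'c) symb \<Rightarrow> 'c set" where
  "cols s = snd (Rep_symb s)"

text \<open>Meaningful only if \<open>K\<close> and \<open>L\<close> are finite nonempty sets of the same cardinality.\<close>

definition Delta :: "'r set \<Rightarrow> 'c set \<Rightarrow> ('r, 'c) symb" where
  "Delta K L = Abs_symb (K, L)"

lemma rows_cols_Delta:
  assumes "finite K" "finite L" "card K = card L" "card K \<ge> 1"
  shows "rows (Delta K L) = K" "cols (Delta K L) = L"
  using assms by (simp_all add: rows_def cols_def Delta_def Abs_symb_inverse)

lemma rows_cols:
  "finite (rows s)" "finite (cols s)" "card (rows s) = card (cols s)" "card (rows s) \<ge> 1"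
  using Rep_symb[of s] by (auto simp: rows_def cols_def)

lemma Delta_rows_cols: "Delta (rows s) (cols s) = s"
  by (simp add: Delta_def rows_def cols_def Rep_symb_inverse)

definition inversions :: "nat \<Rightarrow> (nat \<Rightarrow> nat) \<Rightarrow> nat" where
  "inversions m \<sigma> = card {(i, j). i < j \<and> j < m \<and> \<sigma> i > \<sigma> j}"

text \<open>
  The representative of \<open>D\<^sup>K\<^sub>L\<close> in the free algebra. Positions are counted from 0, so
  \<open>sorted_list_of_set K ! i\<close> is \<open>c\<^sub>K(i + 1)\<close>.
\<close>

definition q_minor :: "'k::field \<Rightarrow> 'r::linorder set \<Rightarrow> 'c::linorder set \<Rightarrow> ('r \<times> 'c, 'k) free_alg" where
  "q_minor q K L = (\<Sum>\<sigma> | \<sigma> permutes {..<card K}.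
     scalar ((- q) ^ inversions (card K) \<sigma>) *
     prod_list (map (\<lambda>i. t (sorted_list_of_set K ! i) (sorted_list_of_set L ! \<sigma> i)) [0..<card K]))"

definition D_minor :: "'k::field \<Rightarrow> 'r::linorder set \<Rightarrow> 'c::linorder set \<Rightarrow> ('r \<times> 'c, 'k) free_alg set" where
  "D_minor q K L = q_class q (q_minor q K L)"


section \<open>Decorated identities\<close>

text \<open>The symbol \<open>\<Delta>\<^sup>K\<^sub>L(i)\<close> is the pair \<open>(\<Delta>\<^sup>K\<^sub>L, i)\<close>.\<close>

type_synonym ('r, 'c) dsymb = "('r, 'c) symb \<times> nat"

text \<open>
  The homomorphism \<open>\<pi>\<close>, factored through the free algebra on the \<open>t\<^sup>\<alpha>\<^sub>\<gamma>\<close>; it is characterised by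
  \<open>pi_hom\<close> and \<open>pi_Delta\<close> below.
\<close>

definition pi_M :: "'k::field \<Rightarrow> (('r::linorder, 'c::linorder) symb, 'k) free_alg
    \<Rightarrow> ('r \<times> 'c, 'k) free_alg set" where
  "pi_M q f = q_class q (free_hom (\<lambda>s. q_minor q (rows s) (cols s)) f)"

lemma pi_hom: "pi_M q \<in> ring_hom ring_of_type_algebra (M_q q)"
  using q_class_hom[of q]
  by (auto simp: ring_hom_def pi_M_def ring_of_type_algebra_def Pi_def)

lemma pi_scalar: "pi_M q (scalar c) = q_class q (scalar c)"
  by (simp add: pi_M_def)

lemma pi_Delta: "pi_M q (gen s) = D_minor q (rows s) (cols s)"
  by (simp add: pi_M_def D_minor_def)

definition pi_N :: "(('r, 'c) dsymb, 'k::field) free_alg \<Rightarrow> (('r, 'c) symb, 'k) free_alg" where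
  "pi_N = free_hom (\<lambda>(s, i). gen s)"

definition decorated_identity :: "'k::field \<Rightarrow> (('r::linorder, 'c::linorder) dsymb, 'k) free_alg \<Rightarrow> bool" where
  "decorated_identity q f \<longleftrightarrow> pi_M q (pi_N f) = \<zero>\<^bsub>M_q q :: ('r \<times> 'c, 'k) free_alg set ring\<^esub>"

definition fsym :: "'r \<Rightarrow> 'c \<Rightarrow> nat \<Rightarrow> ('r, 'c) dsymb" where
  "fsym k l i = (Delta {k} {l}, i)"


section \<open>The replacement rule and the erased identity\<close>

definition replace_hom :: "'r \<Rightarrow> 'r \<Rightarrow> (('r, 'c) dsymb, 'k::field) free_alg \<Rightarrow> (('r, 'c) dsymb, 'k) free_alg" where
  "replace_hom k k' = free_hom (\<lambda>(s, i).
     if i = 1 \<and> k \<in> rows s \<and> k' \<notin> rows s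
     then gen (Delta (rows s - {k} \<union> {k'}) (cols s), 1)
     else gen (s, i))"

definition injective_match :: "'r \<Rightarrow> (('r, 'c) dsymb, 'k::field) free_alg \<Rightarrow> bool" where
  "injective_match k f \<longleftrightarrow> (\<forall>w\<in>Poly_Mapping.keys f.
     \<exists>x. {y \<in> set w. snd y = 1 \<and> k \<in> rows (fst y)} = {x} \<and> count_list w x = 1)"

text \<open>
  The element \<open>f\<^sup>\<or>\<close>. If a symbol decorated by 0 contains two distinct rows including \<open>k'\<close> and
  contains the column \<open>l\<^sub>0\<close>, then erasing leaves a pair of nonempty multilabels of equal size;
  other symbols decorated by 0 are irrelevant.
\<close>

definition erase_hom :: "'r \<Rightarrow> 'c \<Rightarrow> (('r, 'c) dsymb, 'k::field) free_alg \<Rightarrow> (('r, 'c) dsymb, 'k) free_alg" where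
  "erase_hom k' l\<^sub>0 = free_hom (\<lambda>(s, i).
     if i = 0 then gen (Delta (rows s - {k'}) (cols s - {l\<^sub>0}), 0) else gen (s, i))"

definition linearity :: "'r \<Rightarrow> 'c \<Rightarrow> (('r, 'c) dsymb, 'k::field) free_alg \<Rightarrow> bool" where
  "linearity k l\<^sub>0 f \<longleftrightarrow> (\<forall>w\<in>Poly_Mapping.keys f. \<exists>l. l \<noteq> l\<^sub>0 \<and>
     count_list w (fsym k l 1) = 1 \<and> (\<forall>x\<in>set w. x \<noteq> fsym k l 1 \<longrightarrow> snd x = 0))"

definition included_row :: "'r \<Rightarrow> 'r \<Rightarrow> 'c \<Rightarrow> (('r, 'c) dsymb, 'k::field) free_alg \<Rightarrow> bool" where
  "included_row k k' l\<^sub>0 f \<longleftrightarrow> (\<forall>w\<in>Poly_Mapping.keys f. \<forall>x\<in>set w. snd x = 0 \<longrightarrow>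
     k \<in> rows (fst x) \<and> k' \<in> rows (fst x) \<and> l\<^sub>0 \<in> cols (fst x))"

end

theory Submission
  imports Defs
begin

text \<open>
  For rows \<open>a \<noteq> b\<close> let \<open>E\<close> be the twisted derivation \<open>E (x y) = E x \<cdot> \<sigma> y + \<tau> x \<cdot> E y\<close> with
  \<open>E t\<^sup>b\<^sub>\<gamma> = t\<^sup>a\<^sub>\<gamma>\<close> and \<open>E t\<^sup>r\<^sub>\<gamma> = 0\<close> for \<open>r \<noteq> b\<close>, as in the action of a simple root vector of the
  quantum enveloping algebra. Both \<open>\<sigma>\<close> and \<open>\<tau>\<close> kill the rows strictly between \<open>a\<close> and \<open>b\<close>, which
  makes \<open>E\<close> compatible with the relations even if \<open>a\<close> and \<open>b\<close> are not adjacent. On minors without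
  such rows, \<open>E\<close> replaces \<open>b\<close> by \<open>a\<close>, and a minor containing both becomes one with two equal
  adjacent rows, hence zero.

  Apply these operators successively along the rows \<open>k = r\<^sub>0, r\<^sub>1, \<dots>, r\<^sub>n = k'\<close> between \<open>k\<close> and \<open>k'\<close>
  that occur in \<open>f\<close>. The last operator kills every minor containing \<open>k'\<close>, so it has to hit the
  linear factor, which therefore has been hit by all the previous ones. Only the term in which
  \<open>t\<^sup>k\<^sub>l\<close> has become \<open>t\<^sup>k\<^sup>'\<^sub>l\<close> survives. Its coefficient is 1, as the powers of \<open>q\<close> coming from a minor
  that contains both \<open>k\<close> and \<open>k'\<close> cancel.
\<close>

section \<open>The ideal of relations\<close>

lemma ring_of_type_algebra_sel [simp]:
  "carrier ring_of_type_algebra = UNIV"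
  "monoid.mult ring_of_type_algebra = (*)"
  "add ring_of_type_algebra = (+)"
  "one ring_of_type_algebra = 1"
  "zero ring_of_type_algebra = 0"
  by (simp_all add: ring_of_type_algebra_def)

text \<open>This record is what \<open>add_monoid ring_of_type_algebra\<close> becomes under
  simplification; its inverse occurs in the subgroup goals for ideals.\<close>

lemma inv_additive_monoid [simp]:
  "inv\<^bsub>\<lparr>carrier = UNIV, monoid.mult = (+), one = 0\<rparr>\<^esub> (x :: 'a::ring_1) = - x"
proof -
  interpret ring "ring_of_type_algebra :: 'a ring" by (rule ring_ring_of_type_algebra)
  show ?thesis
    using minus_equality[of "- x" x] by (simp add: a_inv_def)
qed

lemma q_ideal_0 [simp]: "0 \<in> q_ideal q"
  using additive_subgroup.zero_closed[OF ideal.axioms(1)[OF ideal_q_ideal], of q] by simp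

lemma q_ideal_add: "x \<in> q_ideal q \<Longrightarrow> y \<in> q_ideal q \<Longrightarrow> x + y \<in> q_ideal q"
  using additive_subgroup.a_closed[OF ideal.axioms(1)[OF ideal_q_ideal], of x q y] by simp

lemma q_ideal_mult_left: "x \<in> q_ideal q \<Longrightarrow> y * x \<in> q_ideal q"
  using ideal.I_l_closed[OF ideal_q_ideal, of x q y] by simp

lemma q_ideal_mult_right: "x \<in> q_ideal q \<Longrightarrow> x * y \<in> q_ideal q"
  using ideal.I_r_closed[OF ideal_q_ideal, of x q y] by simp

lemma q_ideal_uminus: "x \<in> q_ideal q \<Longrightarrow> - x \<in> q_ideal q"
  using q_ideal_mult_left[of x q "- 1"] by simp

lemma q_ideal_diff: "x \<in> q_ideal q \<Longrightarrow> y \<in> q_ideal q \<Longrightarrow> x - y \<in> q_ideal q"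
  using q_ideal_add[of x q "- y"] q_ideal_uminus[of y q] by simp

lemma q_ideal_sum: "(\<And>i. i \<in> A \<Longrightarrow> g i \<in> q_ideal q) \<Longrightarrow> sum g A \<in> q_ideal q"
  by (induction A rule: infinite_finite_induct) (auto intro: q_ideal_add)

lemma q_relators_subset: "q_relators q \<subseteq> q_ideal q"
  unfolding q_ideal_def
  by (rule ring.genideal_self[OF ring_ring_of_type_algebra]) simp

text \<open>The members of \<open>q_ideal q\<close> with property \<open>P\<close> form an ideal
  containing the relators. Closure under negation comes from multiplication by
  \<open>- 1\<close>.\<close>

lemma q_ideal_induct [consumes 1, case_names relator zero add mult_left mult_right]:
  assumes "x \<in> q_ideal q"
    and "\<And>x. x \<in> q_relators q \<Longrightarrow> P x"
    and "P 0"
    and "\<And>x y. x \<in> q_ideal q \<Longrightarrow> y \<in> q_ideal q \<Longrightarrow> P x \<Longrightarrow> P y \<Longrightarrow> P (x + y)"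
    and "\<And>x y. x \<in> q_ideal q \<Longrightarrow> P x \<Longrightarrow> P (y * x)"
    and "\<And>x y. x \<in> q_ideal q \<Longrightarrow> P x \<Longrightarrow> P (x * y)"
  shows "P x"
proof -
  let ?J = "{x \<in> q_ideal q. P x}"
  have neg: "P (- x)" if "x \<in> q_ideal q" "P x" for x
    using assms(5)[OF that, of "- 1"] by simp
  have "ideal ?J ring_of_type_algebra"
  proof (rule idealI[OF ring_ring_of_type_algebra])
    interpret ring "ring_of_type_algebra :: ('a \<times> 'b, 'c) free_alg ring"
      by (rule ring_ring_of_type_algebra)
    show "subgroup ?J (add_monoid ring_of_type_algebra)"
    proof (rule group.subgroupI[OF a_group])
      show "?J \<noteq> {}"
        using assms(3) q_ideal_0 by blast
    qed (simp_all add: neg assms(4) q_ideal_add q_ideal_uminus)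
  qed (simp_all add: assms(5,6) q_ideal_mult_left q_ideal_mult_right)
  then have "genideal ring_of_type_algebra (q_relators q) \<subseteq> ?J"
    using q_relators_subset[of q] assms(2)
    by (intro ring.genideal_minimal[OF ring_ring_of_type_algebra]) auto
  then show ?thesis
    using assms(1) by (auto simp: q_ideal_def)
qed

lemma relator_row: "\<gamma> < \<delta> \<Longrightarrow> t \<alpha> \<gamma> * t \<alpha> \<delta> - scalar q * t \<alpha> \<delta> * t \<alpha> \<gamma> \<in> q_ideal q"
  by (rule subsetD[OF q_relators_subset], unfold q_relators_def, rule UnI1, rule UnI1)
    (rule CollectI, (rule exI)+, rule conjI, rule refl, simp)

lemma relator_col: "\<alpha> < \<beta> \<Longrightarrow> t \<alpha> \<gamma> * t \<beta> \<gamma> - scalar q * t \<beta> \<gamma> * t \<alpha> \<gamma> \<in> q_ideal q"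
  by (rule subsetD[OF q_relators_subset], unfold q_relators_def, rule UnI1, rule UnI2)
    (rule CollectI, (rule exI)+, rule conjI, rule refl, simp)

lemma relator_comm:
  "\<alpha> \<noteq> \<beta> \<Longrightarrow> \<gamma> \<noteq> \<delta> \<Longrightarrow> (t \<alpha> \<gamma> * t \<beta> \<delta> - t \<beta> \<delta> * t \<alpha> \<gamma>)
    - scalar ((q - inverse q) * (of_bool (\<delta> > \<gamma>) - of_bool (\<alpha> > \<beta>))) * t \<beta> \<gamma> * t \<alpha> \<delta> \<in> q_ideal q"
  by (rule subsetD[OF q_relators_subset], unfold q_relators_def, rule UnI2)
    (rule CollectI, (rule exI)+, rule conjI, rule refl, simp)

text \<open>The zero of the quotient ring is the coset \<open>q_ideal q\<close>, so identities in
  \<open>M_q\<close> become membership statements in the free algebra, where all later computations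
  take place.\<close>

lemma decorated_identity_iff:
  "decorated_identity q f \<longleftrightarrow>
     free_hom (\<lambda>s. q_minor q (rows s) (cols s)) (pi_N f) \<in> q_ideal q" (is "_ \<longleftrightarrow> ?x \<in> _")
proof -
  interpret ideal "q_ideal q" ring_of_type_algebra by (rule ideal_q_ideal)
  have "q_class q ?x = q_ideal q \<longleftrightarrow> ?x \<in> q_ideal q"
    unfolding q_class_def using a_coset_join1[of "q_ideal q" ?x] a_coset_join2[of ?x "q_ideal q"]
      a_subgroup by auto
  then show ?thesis
    by (simp add: decorated_identity_def pi_M_def M_q_def FactRing_def)
qed


section \<open>Twisted derivations of free algebras\<close>

lemma scalar_left_commute: "x * (scalar c * y) = scalar c * (x * (y :: ('x, 'k::field) free_alg))"
  by (metis mult.assoc scalar_commute)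

lemma scalar_minus: "scalar (a - b) = scalar a - scalar b" "scalar (- a) = - scalar a"
  by (simp_all add: scalar_def single_diff single_uminus)

lemma gen_mult_single: "gen x * Poly_Mapping.single w c = Poly_Mapping.single (x # w) (c :: 'k::field)"
  by (simp add: gen_def mult_single plus_list_def)

lemma single_Nil [simp]: "Poly_Mapping.single [] (1 :: 'k::field) = 1"
  by (simp flip: zero_list_def)

lemma prod_list_gen: "prod_list (map gen w) = Poly_Mapping.single w (1 :: 'k::field)"
  by (induction w) (simp_all add: gen_mult_single)

lemma free_alg_induct [case_names one gen scalar add]:
  fixes f :: "('x, 'k::field) free_alg"
  assumes "P 1" "\<And>x f. P f \<Longrightarrow> P (gen x * f)" "\<And>c f. P f \<Longrightarrow> P (scalar c * f)"
    and add: "\<And>f g. P f \<Longrightarrow> P g \<Longrightarrow> P (f + g)"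
  shows "P f"
proof -
  have *: "P (Poly_Mapping.single w c)" for w c
  proof -
    have "P (prod_list (map gen w))"
      by (induction w) (simp_all add: assms)
    then have "P (scalar c * Poly_Mapping.single w 1)"
      by (simp add: prod_list_gen assms)
    then show ?thesis
      by (simp add: scalar_def mult_single plus_list_def)
  qed
  show ?thesis
  proof (induction f rule: update_induct)
    case const
    show ?case using *[of "[]" 0] by simp
  next
    case (update f w b)
    have "Poly_Mapping.update w b f = f + Poly_Mapping.single w b"
      using update(1) by (intro poly_mapping_eqI)
        (auto simp: lookup_update lookup_add lookup_single in_keys_iff when_def)
    then show ?case
      using update * add by simp
  qed
qed

text \<open>Unrolls the twisted Leibniz rule: the letter hit by \<open>e\<close> has
  \<open>\<tau>\<close> applied to the letters before it and \<open>\<sigma>\<close> to those after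
  it.\<close>

primrec twisted_deriv_word where
  "twisted_deriv_word e \<sigma> \<tau> [] = (0 :: ('y, 'k::field) free_alg)"
| "twisted_deriv_word e \<sigma> \<tau> (x # w) = e x * prod_list (map \<sigma> w) + \<tau> x * twisted_deriv_word e \<sigma> \<tau> w"

definition twisted_deriv :: "('x \<Rightarrow> ('y, 'k::field) free_alg) \<Rightarrow> ('x \<Rightarrow> ('y, 'k) free_alg)
    \<Rightarrow> ('x \<Rightarrow> ('y, 'k) free_alg) \<Rightarrow> ('x, 'k) free_alg \<Rightarrow> ('y, 'k) free_alg" where
  "twisted_deriv e \<sigma> \<tau> f =
     (\<Sum>w\<in>Poly_Mapping.keys f. scalar (Poly_Mapping.lookup f w) * twisted_deriv_word e \<sigma> \<tau> w)"

lemma twisted_deriv_superset: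
  assumes "finite S" "Poly_Mapping.keys f \<subseteq> S"
  shows "twisted_deriv e \<sigma> \<tau> f =
    (\<Sum>w\<in>S. scalar (Poly_Mapping.lookup f w) * twisted_deriv_word e \<sigma> \<tau> w)"
  unfolding twisted_deriv_def using assms
  by (intro sum.mono_neutral_left) (auto simp: in_keys_iff scalar_simps)

lemma twisted_deriv_0 [simp]: "twisted_deriv e \<sigma> \<tau> 0 = 0"
  by (simp add: twisted_deriv_def)

lemma twisted_deriv_add [simp]:
  "twisted_deriv e \<sigma> \<tau> (f + g) = twisted_deriv e \<sigma> \<tau> f + twisted_deriv e \<sigma> \<tau> g"
proof -
  let ?S = "Poly_Mapping.keys f \<union> Poly_Mapping.keys g"
  have "twisted_deriv e \<sigma> \<tau> h =
      (\<Sum>w\<in>?S. scalar (Poly_Mapping.lookup h w) * twisted_deriv_word e \<sigma> \<tau> w)"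
    if "h \<in> {f, g, f + g}" for h
    using that Poly_Mapping.keys_add[of f g] by (intro twisted_deriv_superset) auto
  then show ?thesis
    by (simp add: lookup_add scalar_simps distrib_right sum.distrib)
qed

lemma lookup_scalar_mult: "Poly_Mapping.lookup (scalar c * f) w = c * Poly_Mapping.lookup f w"
proof (induction f rule: update_induct)
  case const
  show ?case by simp
next
  case (update f v b)
  have "Poly_Mapping.update v b f = f + Poly_Mapping.single v b"
    using update(1) by (intro poly_mapping_eqI)
      (auto simp: lookup_update lookup_add lookup_single in_keys_iff when_def)
  then show ?case
    using update
    by (simp add: distrib_left lookup_add scalar_def mult_single plus_list_def lookup_single when_def)
qed

lemma twisted_deriv_scalar [simp]:
  "twisted_deriv e \<sigma> \<tau> (scalar c * f) = scalar c * twisted_deriv e \<sigma> \<tau> f"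
  by (subst twisted_deriv_superset[of "Poly_Mapping.keys f"])
    (auto simp: twisted_deriv_def lookup_scalar_mult in_keys_iff scalar_simps sum_distrib_left mult.assoc)

lemma twisted_deriv_single:
  "twisted_deriv e \<sigma> \<tau> (Poly_Mapping.single w c) = scalar c * twisted_deriv_word e \<sigma> \<tau> w"
  by (cases "c = 0") (simp_all add: twisted_deriv_def scalar_simps)

lemma twisted_deriv_one [simp]: "twisted_deriv e \<sigma> \<tau> 1 = 0"
  using twisted_deriv_single[of e \<sigma> \<tau> "[]" 1] by simp

lemma twisted_deriv_gen_mult:
  "twisted_deriv e \<sigma> \<tau> (gen x * f) = e x * free_hom \<sigma> f + \<tau> x * twisted_deriv e \<sigma> \<tau> f"
proof (induction f rule: update_induct)
  case const
  show ?case by (simp add: free_hom_def)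
next
  case (update f w b)
  have "Poly_Mapping.update w b f = f + Poly_Mapping.single w b"
    using update(1) by (intro poly_mapping_eqI)
      (auto simp: lookup_update lookup_add lookup_single in_keys_iff when_def)
  then show ?case
    using update
    by (simp add: distrib_left twisted_deriv_single gen_mult_single free_hom_single
        scalar_left_commute[of "\<tau> x"] scalar_left_commute[of "e x"] scalar_left_commute[of "gen x"])
qed

lemma twisted_deriv_gen [simp]: "twisted_deriv e \<sigma> \<tau> (gen x) = e x"
  using twisted_deriv_gen_mult[of e \<sigma> \<tau> x 1] by simp

text \<open>The recursion on words splits off letters on the left, so induction on the left factor
  suffices.\<close>

lemma twisted_deriv_mult:
  "twisted_deriv e \<sigma> \<tau> (f * g) =
     twisted_deriv e \<sigma> \<tau> f * free_hom \<sigma> g + free_hom \<tau> f * twisted_deriv e \<sigma> \<tau> g"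
  by (induction f rule: free_alg_induct)
    (simp_all add: mult.assoc twisted_deriv_gen_mult distrib_left distrib_right)

lemma twisted_deriv_uminus [simp]: "twisted_deriv e \<sigma> \<tau> (- f) = - twisted_deriv e \<sigma> \<tau> f"
  using twisted_deriv_add[of e \<sigma> \<tau> f "- f"] by (simp add: eq_neg_iff_add_eq_0 add.commute)

lemma twisted_deriv_diff [simp]:
  "twisted_deriv e \<sigma> \<tau> (f - g) = twisted_deriv e \<sigma> \<tau> f - twisted_deriv e \<sigma> \<tau> g"
  using twisted_deriv_add[of e \<sigma> \<tau> f "- g"] by simp

lemma twisted_deriv_sum: "twisted_deriv e \<sigma> \<tau> (sum g A) = (\<Sum>i\<in>A. twisted_deriv e \<sigma> \<tau> (g i))"
  by (induction A rule: infinite_finite_induct) simp_all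

lemma free_hom_0 [simp]: "free_hom g 0 = 0"
  by (simp add: free_hom_def)

lemma free_hom_uminus [simp]: "free_hom g (- f) = - free_hom g f"
  using free_hom_add[of g f "- f"] by (simp add: eq_neg_iff_add_eq_0 add.commute)

lemma free_hom_diff [simp]: "free_hom g (e - f) = free_hom g e - free_hom g f"
  using free_hom_add[of g e "- f"] by simp

lemma free_hom_sum: "free_hom g (sum h A) = (\<Sum>i\<in>A. free_hom g (h i))"
  by (induction A rule: infinite_finite_induct) simp_all

section \<open>Moving a row to a neighbouring row\<close>

text \<open>Rewrite rules that gather all scalars in front. Commutation is stated only for
  generators on the left, so two scalars are never swapped back and forth.\<close>

lemma scalar_normalize:
  "gen x * scalar c = scalar c * (gen x :: ('x, 'k::field) free_alg)"
  "gen x * (scalar c * f) = scalar c * (gen x * f :: ('x, 'k) free_alg)"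
  "scalar a * scalar b = (scalar (a * b) :: ('x, 'k) free_alg)"
  "scalar a * (scalar b * f) = scalar (a * b) * (f :: ('x, 'k) free_alg)"
  by (rule scalar_commute[symmetric], rule scalar_left_commute)
    (simp_all add: scalar_simps mult.assoc)

text \<open>The torus action on rows. Weights may be 0, and then every word meeting that row is
  killed.\<close>

definition row_scale :: "('r \<Rightarrow> 'k::field) \<Rightarrow> 'r \<times> 'c \<Rightarrow> ('r \<times> 'c, 'k) free_alg" where
  "row_scale w = (\<lambda>(r, c). scalar (w r) * t r c)"

text \<open>All terms of a relator involve the same rows with the same multiplicities, so scaling
  multiplies the relator by a scalar, possibly 0.\<close>

lemma row_scale_q_ideal:
  assumes "x \<in> q_ideal q"
  shows "free_hom (row_scale w) x \<in> q_ideal q"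
  using assms
proof (induction rule: q_ideal_induct)
  case (relator x)
  have "\<exists>c. free_hom (row_scale w) x = scalar c * x"
    using relator unfolding q_relators_def
  proof (elim UnE CollectE exE conjE, goal_cases)
    case (1 \<alpha> \<gamma> \<delta>)
    show ?case
      by (rule exI[of _ "w \<alpha> * w \<alpha>"])
        (simp add: 1 row_scale_def mult.assoc scalar_normalize right_diff_distrib mult_ac)
  next
    case (2 \<alpha> \<beta> \<gamma>)
    show ?case
      by (rule exI[of _ "w \<alpha> * w \<beta>"])
        (simp add: 2 row_scale_def mult.assoc scalar_normalize right_diff_distrib mult_ac)
  next
    case (3 \<alpha> \<beta> \<gamma> \<delta>)
    show ?case
      by (rule exI[of _ "w \<alpha> * w \<beta>"])
        (simp add: 3 row_scale_def mult.assoc scalar_normalize right_diff_distrib mult_ac)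
  qed
  then obtain c where "free_hom (row_scale w) x = scalar c * x" ..
  then show ?case
    using q_ideal_mult_left[OF subsetD[OF q_relators_subset relator]] by simp
qed (simp_all add: q_ideal_add q_ideal_mult_left q_ideal_mult_right)

section \<open>The operator moving row \<open>b\<close> to row \<open>a\<close>, and its
  compatibility with the relations\<close>

definition between :: "'r::linorder \<Rightarrow> 'r \<Rightarrow> 'r set" where
  "between a b = {min a b<..<max a b}"

lemma not_between [simp]: "a \<notin> between a b" "b \<notin> between a b"
  by (auto simp: between_def min_def max_def)

text \<open>A row outside the interval lies on the same side of both ends, so putting
  \<open>a\<close> in place of \<open>b\<close> changes no relation with it.\<close>

lemma less_iff_less_not_between:
  assumes "r \<notin> between a b" "r \<noteq> a" "r \<noteq> b"
  shows "r < b \<longleftrightarrow> r < a" "b < r \<longleftrightarrow> a < r"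
  using assms by (auto simp: between_def min_def max_def split: if_splits)

definition shift_factor :: "'k::field \<Rightarrow> 'r::linorder \<Rightarrow> 'r \<Rightarrow> 'k" where
  "shift_factor q a b = (if a < b then q else inverse q)"

text \<open>The weight at \<open>a\<close> makes the image of the column relation between rows
  \<open>a\<close> and \<open>b\<close> vanish; the weight at \<open>b\<close> is the one that the
  relation inside row \<open>b\<close> requires.\<close>

definition shift_weight :: "'k::field \<Rightarrow> 'r::linorder \<Rightarrow> 'r \<Rightarrow> 'r \<Rightarrow> 'k" where
  "shift_weight q a b r = (if r \<in> between a b then 0
     else if r = a then inverse (shift_factor q a b)
     else if r = b then shift_factor q a b else 1)"

definition shift_deriv :: "'k::field \<Rightarrow> 'r::linorder \<Rightarrow> 'r \<Rightarrow> ('r \<times> 'c::linorder, 'k) free_alg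
    \<Rightarrow> ('r \<times> 'c, 'k) free_alg" where
  "shift_deriv q a b = twisted_deriv (\<lambda>(r, c). if r = b then t a c else 0)
     (row_scale (shift_weight q a b)) (row_scale (\<lambda>r. of_bool (r \<notin> between a b)))"

lemma shift_deriv_t_mult_t:
  "shift_deriv q a b (t \<alpha> \<gamma> * t \<beta> \<delta>) =
     (if \<alpha> = b then scalar (shift_weight q a b \<beta>) * (t a \<gamma> * t \<beta> \<delta>) else 0) +
     (if \<beta> = b \<and> \<alpha> \<notin> between a b then t \<alpha> \<gamma> * t a \<delta> else 0)"
  by (simp add: shift_deriv_def twisted_deriv_mult row_scale_def scalar_normalize scalar_simps)

lemma shift_deriv_linear [simp]:
  "shift_deriv q a b 0 = 0"
  "shift_deriv q a b 1 = 0"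
  "shift_deriv q a b (x + y) = shift_deriv q a b x + shift_deriv q a b y"
  "shift_deriv q a b (x - y) = shift_deriv q a b x - shift_deriv q a b y"
  "shift_deriv q a b (scalar c * x) = scalar c * shift_deriv q a b x"
  "shift_deriv q a b (t r \<gamma>) = (if r = b then t a \<gamma> else 0)"
  by (simp_all add: shift_deriv_def)

text \<open>For \<open>\<alpha> = b\<close> the image mixes rows \<open>a\<close> and
  \<open>b\<close> in two columns and is a combination of the two commutation relators
  \<open>?r1\<close>, \<open>?r2\<close> between these rows.\<close>

lemma shift_deriv_relator_row:
  assumes "q \<noteq> 0" "a \<noteq> b" "\<gamma> < \<delta>"
  shows "shift_deriv q a b (t \<alpha> \<gamma> * t \<alpha> \<delta> - scalar q * t \<alpha> \<delta> * t \<alpha> \<gamma>) \<in> q_ideal q"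
proof (cases "\<alpha> = b")
  case True
  have "\<not> \<delta> < \<gamma>"
    using assms(3) by simp
  show ?thesis
  proof (cases "a < b")
    case True
    then have ab: "a < b" "\<not> b < a"
      by auto
    let ?r1 = "t a \<gamma> * t b \<delta> - t b \<delta> * t a \<gamma> - scalar (q - inverse q) * t b \<gamma> * t a \<delta>"
    let ?r2 = "t a \<delta> * t b \<gamma> - t b \<gamma> * t a \<delta>"
    have "?r1 \<in> q_ideal q"
      using relator_comm[of a b \<gamma> \<delta> q] assms ab by simp
    moreover have "?r2 \<in> q_ideal q"
      using relator_comm[of a b \<delta> \<gamma> q] assms ab \<open>\<not> \<delta> < \<gamma>\<close> by (simp add: scalar_simps)
    \<comment> \<open>In the image, \<open>t a \<gamma> * t b \<delta>\<close> and
      \<open>t a \<delta> * t b \<gamma>\<close> have coefficients \<open>q\<close> and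
      \<open>- (q * q)\<close>; this fixes the multiples of the relators.\<close>
    ultimately have "scalar q * ?r1 - scalar (q * q) * ?r2 \<in> q_ideal q"
      by (rule q_ideal_diff[OF q_ideal_mult_left q_ideal_mult_left])
    also have "scalar q * ?r1 - scalar (q * q) * ?r2 =
        shift_deriv q a b (t \<alpha> \<gamma> * t \<alpha> \<delta> - scalar q * t \<alpha> \<delta> * t \<alpha> \<gamma>)"
      using assms(1,2) ab \<open>\<alpha> = b\<close>
      by (simp add: mult.assoc shift_deriv_t_mult_t shift_weight_def shift_factor_def
          scalar_normalize algebra_simps scalar_minus scalar_simps(2))
    finally show ?thesis .
  next
    case False
    then have ab: "\<not> a < b" "b < a"
      using assms(2) by auto
    let ?r1 = "t a \<gamma> * t b \<delta> - t b \<delta> * t a \<gamma>"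
    let ?r2 = "t a \<delta> * t b \<gamma> - t b \<gamma> * t a \<delta> - scalar (inverse q - q) * t b \<delta> * t a \<gamma>"
    have "?r1 \<in> q_ideal q"
      using relator_comm[of a b \<gamma> \<delta> q] assms ab \<open>\<not> \<delta> < \<gamma>\<close> by (simp add: scalar_simps)
    moreover have "?r2 \<in> q_ideal q"
      using relator_comm[of a b \<delta> \<gamma> q] assms ab \<open>\<not> \<delta> < \<gamma>\<close> by simp
    ultimately have "scalar (inverse q) * ?r1 - ?r2 \<in> q_ideal q"
      by (rule q_ideal_diff[OF q_ideal_mult_left])
    also have "scalar (inverse q) * ?r1 - ?r2 =
        shift_deriv q a b (t \<alpha> \<gamma> * t \<alpha> \<delta> - scalar q * t \<alpha> \<delta> * t \<alpha> \<gamma>)"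
      using assms(1,2) ab \<open>\<alpha> = b\<close>
      by (simp add: mult.assoc shift_deriv_t_mult_t shift_weight_def shift_factor_def
          scalar_normalize algebra_simps scalar_minus scalar_simps(2))
    finally show ?thesis .
  qed
qed (simp add: mult.assoc shift_deriv_t_mult_t)

text \<open>If the row other than \<open>b\<close> is \<open>a\<close>, the two terms of the image
  cancel by the choice of weight; if it lies between, both are cut away; otherwise the image is the
  column relator with \<open>a\<close> in place of \<open>b\<close>.\<close>

lemma shift_deriv_relator_col:
  assumes "q \<noteq> 0" "a \<noteq> b" "\<alpha> < \<beta>"
  shows "shift_deriv q a b (t \<alpha> \<gamma> * t \<beta> \<gamma> - scalar q * t \<beta> \<gamma> * t \<alpha> \<gamma>) \<in> q_ideal q"
proof -
  let ?w = "shift_weight q a b" and ?B = "between a b"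
  have *: "shift_deriv q a b (t \<alpha> \<gamma> * t \<beta> \<gamma> - scalar q * t \<beta> \<gamma> * t \<alpha> \<gamma>) =
     (if \<alpha> = b then scalar (?w \<beta>) * (t a \<gamma> * t \<beta> \<gamma>) - scalar (q * of_bool (\<beta> \<notin> ?B)) * (t \<beta> \<gamma> * t a \<gamma>) else 0) +
     (if \<beta> = b then scalar (of_bool (\<alpha> \<notin> ?B)) * (t \<alpha> \<gamma> * t a \<gamma>) - scalar (q * ?w \<alpha>) * (t a \<gamma> * t \<alpha> \<gamma>) else 0)"
    using assms
    by (cases "\<alpha> = b"; cases "\<beta> = b")
      (simp_all add: mult.assoc shift_deriv_t_mult_t scalar_normalize scalar_simps(1,2))
  have rel: "scalar (of_bool (x \<notin> ?B)) * (t x \<gamma> * t y \<gamma>) -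
      scalar (q * (of_bool (x \<notin> ?B))) * (t y \<gamma> * t x \<gamma>) \<in> q_ideal q" if "x < y" for x y
    using relator_col[OF that, of \<gamma> q] by (simp add: mult.assoc scalar_simps(1,2))
  have "scalar (?w \<beta>) * (t a \<gamma> * t \<beta> \<gamma>) - scalar (q * of_bool (\<beta> \<notin> ?B)) * (t \<beta> \<gamma> * t a \<gamma>) \<in> q_ideal q"
    if "\<alpha> = b"
  proof (cases "\<beta> = a \<or> \<beta> \<in> ?B")
    case True
    then show ?thesis
      using that assms by (auto simp: shift_weight_def shift_factor_def scalar_simps(1,2))
  next
    case False
    then have "a < \<beta>"
      using that assms less_iff_less_not_between[of \<beta> a b] by simp
    then show ?thesis
      using relator_col[of a \<beta> \<gamma> q] False that assms
      by (auto simp: shift_weight_def mult.assoc scalar_simps)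
  qed
  moreover have "scalar (of_bool (\<alpha> \<notin> ?B)) * (t \<alpha> \<gamma> * t a \<gamma>) - scalar (q * ?w \<alpha>) * (t a \<gamma> * t \<alpha> \<gamma>) \<in> q_ideal q"
    if "\<beta> = b"
  proof (cases "\<alpha> = a \<or> \<alpha> \<in> ?B")
    case True
    then show ?thesis
      using that assms by (auto simp: shift_weight_def shift_factor_def scalar_simps(1,2))
  next
    case False
    then have "\<alpha> < a"
      using that assms less_iff_less_not_between[of \<alpha> a b] by simp
    then show ?thesis
      using relator_col[of \<alpha> a \<gamma> q] False that assms
      by (auto simp: shift_weight_def mult.assoc scalar_simps)
  qed
  ultimately show ?thesis
    unfolding * by (intro q_ideal_add) simp_all
qed

text \<open>The same case distinction as for columns, except that a second row equal to
  \<open>a\<close> now leaves a multiple of the relation inside row \<open>a\<close>.\<close>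

lemma shift_deriv_relator_comm:
  assumes "q \<noteq> 0" "a \<noteq> b" "\<alpha> \<noteq> \<beta>" "\<gamma> \<noteq> \<delta>"
  shows "shift_deriv q a b ((t \<alpha> \<gamma> * t \<beta> \<delta> - t \<beta> \<delta> * t \<alpha> \<gamma>) -
     scalar ((q - inverse q) * (of_bool (\<delta> > \<gamma>) - of_bool (\<alpha> > \<beta>))) * t \<beta> \<gamma> * t \<alpha> \<delta>) \<in> q_ideal q"
proof -
  let ?w = "shift_weight q a b" and ?B = "between a b"
  define c where "c = (q - inverse q) * (of_bool (\<delta> > \<gamma>) - of_bool (\<alpha> > \<beta>))"
  \<comment> \<open>\<open>u\<close> and \<open>v\<close> are the images when row \<open>b\<close>
    is \<open>\<alpha>\<close> and when it is \<open>\<beta>\<close>.\<close>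
  define u where "u = scalar (?w \<beta>) * (t a \<gamma> * t \<beta> \<delta>)
     - scalar (of_bool (\<beta> \<notin> ?B)) * (t \<beta> \<delta> * t a \<gamma>)
     - scalar (c * of_bool (\<beta> \<notin> ?B)) * (t \<beta> \<gamma> * t a \<delta>)"
  define v where "v = scalar (of_bool (\<alpha> \<notin> ?B)) * (t \<alpha> \<gamma> * t a \<delta>)
     - scalar (?w \<alpha>) * (t a \<delta> * t \<alpha> \<gamma>)
     - scalar (c * ?w \<alpha>) * (t a \<gamma> * t \<alpha> \<delta>)"
  have *: "shift_deriv q a b ((t \<alpha> \<gamma> * t \<beta> \<delta> - t \<beta> \<delta> * t \<alpha> \<gamma>) - scalar c * t \<beta> \<gamma> * t \<alpha> \<delta>) =
     (if \<alpha> = b then u else 0) + (if \<beta> = b then v else 0)"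
    using assms
    by (cases "\<alpha> = b"; cases "\<beta> = b")
      (simp_all add: mult.assoc shift_deriv_t_mult_t scalar_normalize scalar_simps(1,2) u_def v_def
        right_diff_distrib distrib_left)
  \<comment> \<open>The relation inside row \<open>a\<close>, in a form that covers both orders of
    the two columns.\<close>
  have row: "scalar (if \<gamma> < \<delta> then inverse q else q) * (t a \<gamma> * t a \<delta>) - t a \<delta> * t a \<gamma> \<in> q_ideal q"
  proof (cases "\<gamma> < \<delta>")
    case True
    then have "scalar (inverse q) * (t a \<gamma> * t a \<delta> - scalar q * t a \<delta> * t a \<gamma>) \<in> q_ideal q"
      by (intro q_ideal_mult_left relator_row)
    then show ?thesis
      using True assms(1) by (simp add: mult.assoc scalar_normalize right_diff_distrib scalar_simps(2))
  next
    case False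
    then have "- (t a \<delta> * t a \<gamma> - scalar q * t a \<gamma> * t a \<delta>) \<in> q_ideal q"
      using assms(4) by (intro q_ideal_uminus relator_row) simp
    then show ?thesis
      using False by (simp add: mult.assoc)
  qed
  have "u \<in> q_ideal q" if "\<alpha> = b"
  proof (cases "\<beta> = a")
    case True
    then show ?thesis
      using that assms row
      by (auto simp: u_def c_def shift_weight_def shift_factor_def scalar_simps(1,2)
          scalar_normalize algebra_simps scalar_minus split: if_splits)
  next
    case False
    then show ?thesis
      using that assms relator_comm[of a \<beta> \<gamma> \<delta> q] less_iff_less_not_between[of \<beta> a b]
      by (auto simp: u_def c_def shift_weight_def mult.assoc scalar_simps(1,2))
  qed
  moreover have "v \<in> q_ideal q" if "\<beta> = b"
  proof (cases "\<alpha> = a")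
    case True
    then show ?thesis
      using that assms q_ideal_mult_left[OF row, of "scalar (?w a)"]
      by (auto simp: v_def c_def shift_weight_def shift_factor_def scalar_simps(1,2)
          scalar_normalize algebra_simps scalar_minus split: if_splits)
  next
    case False
    then show ?thesis
      using that assms relator_comm[of \<alpha> a \<gamma> \<delta> q] less_iff_less_not_between[of \<alpha> a b]
      by (auto simp: v_def c_def shift_weight_def mult.assoc scalar_simps(1,2))
  qed
  ultimately show ?thesis
    unfolding c_def[symmetric] * by (intro q_ideal_add) simp_all
qed

lemma shift_deriv_mult:
  "shift_deriv q a b (x * y) = shift_deriv q a b x * free_hom (row_scale (shift_weight q a b)) y +
     free_hom (row_scale (\<lambda>r. of_bool (r \<notin> between a b))) x * shift_deriv q a b y"
  by (simp add: shift_deriv_def twisted_deriv_mult)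

text \<open>Relators are treated kind by kind; for products, the twisted Leibniz rule also uses that
  row scalings preserve the ideal.\<close>

lemma shift_deriv_q_ideal:
  assumes "q \<noteq> 0" "a \<noteq> b" "x \<in> q_ideal q"
  shows "shift_deriv q a b x \<in> q_ideal q"
  using assms(3)
proof (induction rule: q_ideal_induct)
  case (relator x)
  then show ?case
    unfolding q_relators_def using assms(1,2)
    by (elim UnE CollectE exE conjE)
      (simp_all only: shift_deriv_relator_row shift_deriv_relator_col shift_deriv_relator_comm
        simp_thms not_False_eq_True)
qed (simp_all add: shift_deriv_mult q_ideal_add q_ideal_mult_left q_ideal_mult_right row_scale_q_ideal)


section \<open>Shifting rows of quantum minors\<close>

text \<open>Swapping neighbouring positions preserves the order of every other pair of positions, so
  \<open>T\<close> carries the old inversions to the new ones, all but the extra one at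
  \<open>(i, Suc i)\<close>.\<close>

lemma inversions_comp_transpose:
  assumes "Suc i < m" "\<sigma> i < \<sigma> (Suc i)"
  shows "inversions m (\<sigma> \<circ> transpose i (Suc i)) = Suc (inversions m \<sigma>)"
proof -
  define T where "T = transpose i (Suc i)"
  define Inv where "Inv = (\<lambda>\<sigma> :: nat \<Rightarrow> nat. {(j, k). j < k \<and> k < m \<and> \<sigma> j > \<sigma> k})"
  have TT: "T (T j) = j" for j
    by (simp add: T_def)
  have mono: "T j < T k" if "j < k" "(j, k) \<noteq> (i, Suc i)" for j k
    using that by (auto simp: T_def transpose_def)
  have bound: "T k < m" if "k < m" for k
    using that assms(1) by (auto simp: T_def transpose_def)
  have "Inv (\<sigma> \<circ> T) = insert (i, Suc i) (map_prod T T ` Inv \<sigma>)"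
  proof (intro equalityI subsetI; clarify)
    fix j k assume jk: "(j, k) \<in> Inv (\<sigma> \<circ> T)" "(j, k) \<notin> map_prod T T ` Inv \<sigma>"
    show "j = i \<and> k = Suc i"
    proof (rule ccontr)
      assume "\<not> (j = i \<and> k = Suc i)"
      then have "(T j, T k) \<in> Inv \<sigma>"
        using jk(1) mono[of j k] bound by (auto simp: Inv_def)
      then have "map_prod T T (T j, T k) \<in> map_prod T T ` Inv \<sigma>"
        by blast
      then show False
        using jk(2) by (simp add: TT)
    qed
  next
    fix j k assume *: "(j, k) \<in> insert (i, Suc i) (map_prod T T ` Inv \<sigma>)"
    show "(j, k) \<in> Inv (\<sigma> \<circ> T)"
    proof (cases "(j, k) = (i, Suc i)")
      case True
      then show ?thesis
        using assms by (simp add: Inv_def T_def)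
    next
      case False
      then obtain j' k' where "(j', k') \<in> Inv \<sigma>" "j = T j'" "k = T k'"
        using * by auto
      moreover from this have "(j', k') \<noteq> (i, Suc i)"
        using assms by (auto simp: Inv_def)
      ultimately show ?thesis
        using mono[of j' k'] bound by (auto simp: Inv_def TT)
    qed
  qed
  moreover have "finite (Inv \<sigma>)"
    by (rule finite_subset[of _ "{..<m} \<times> {..<m}"]) (auto simp: Inv_def)
  moreover have "inj (map_prod T T)"
    by (rule injI) (metis TT map_prod_simp surj_pair prod.inject)
  moreover have "(i, Suc i) \<notin> map_prod T T ` Inv \<sigma>"
    by (auto simp: Inv_def T_def transpose_def split: if_splits)
  ultimately have "card (Inv (\<sigma> \<circ> T)) = Suc (card (Inv \<sigma>))"
    by (simp add: card_image inj_on_subset)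
  then show ?thesis
    by (simp add: inversions_def Inv_def T_def)
qed

definition minor_word :: "'r list \<Rightarrow> 'c list \<Rightarrow> (nat \<Rightarrow> nat) \<Rightarrow> ('r \<times> 'c, 'k::field) free_alg" where
  "minor_word rs ls \<sigma> = prod_list (map (\<lambda>i. t (rs ! i) (ls ! \<sigma> i)) [0..<length rs])"

text \<open>Lists of rows admit the repetition that arises when \<open>b\<close> becomes an
  \<open>a\<close> that is already present.\<close>

definition row_minor :: "'k::field \<Rightarrow> 'r list \<Rightarrow> 'c list \<Rightarrow> ('r \<times> 'c, 'k) free_alg" where
  "row_minor q rs ls = (\<Sum>\<sigma> | \<sigma> permutes {..<length rs}.
     scalar ((- q) ^ inversions (length rs) \<sigma>) * minor_word rs ls \<sigma>)"

lemma q_minor_eq_row_minor: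
  "q_minor q K L = row_minor q (sorted_list_of_set K) (sorted_list_of_set L)"
  by (simp add: q_minor_def row_minor_def minor_word_def)

lemma minor_word_split:
  assumes "Suc i < length rs"
  shows "minor_word rs ls \<sigma> = prod_list (map (\<lambda>j. t (rs ! j) (ls ! \<sigma> j)) [0..<i])
     * (t (rs ! i) (ls ! \<sigma> i) * t (rs ! Suc i) (ls ! \<sigma> (Suc i)))
     * prod_list (map (\<lambda>j. t (rs ! j) (ls ! \<sigma> j)) [Suc (Suc i)..<length rs])"
proof -
  have "[0..<length rs] = [0..<i] @ [i..<length rs]"
    using assms upt_add_eq_append[of 0 i "length rs - i"] by simp
  also have "[i..<length rs] = i # Suc i # [Suc (Suc i)..<length rs]"
    using assms by (simp add: upt_conv_Cons)
  finally show ?thesis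
    by (simp add: minor_word_def mult.assoc)
qed

text \<open>The summands of \<open>\<sigma>\<close> and \<open>\<sigma> \<circ> T\<close> differ
  only by swapping two factors in the same row, and together they form a multiple of a
  relator.\<close>

lemma row_minor_repeated_row:
  fixes q :: "'k::field" and rs :: "'r::linorder list" and ls :: "'c::linorder list"
  assumes ls: "sorted ls" "distinct ls" "length ls = length rs"
    and i: "Suc i < length rs" "rs ! Suc i = rs ! i"
  shows "row_minor q rs ls \<in> q_ideal q"
proof -
  define m where "m = length rs"
  define T where "T = transpose i (Suc i)"
  define F where "F \<sigma> = scalar ((- q) ^ inversions m \<sigma>) * minor_word rs ls \<sigma>" for \<sigma>
  define S where "S = {\<sigma>. \<sigma> permutes {..<m} \<and> \<sigma> i < \<sigma> (Suc i)}"
  have TT: "\<sigma> \<circ> T \<circ> T = \<sigma>" for \<sigma> :: "nat \<Rightarrow> nat"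
    by (simp add: T_def fun_eq_iff)
  have perm: "\<sigma> \<circ> T permutes {..<m}" if "\<sigma> permutes {..<m}" for \<sigma>
    using that i(1) unfolding T_def
    by (intro permutes_compose permutes_swap_id) (auto simp: m_def)
  \<comment> \<open>A permutation without an ascent at \<open>i\<close> acquires one by composing
    with \<open>T\<close>.\<close>
  have "{\<sigma>. \<sigma> permutes {..<m}} = S \<union> (\<lambda>\<sigma>. \<sigma> \<circ> T) ` S"
  proof (intro equalityI subsetI)
    fix \<sigma> assume "\<sigma> \<in> {\<sigma>. \<sigma> permutes {..<m}}"
    then have \<sigma>: "\<sigma> permutes {..<m}" by simp
    show "\<sigma> \<in> S \<union> (\<lambda>\<sigma>. \<sigma> \<circ> T) ` S"
    proof (cases "\<sigma> i < \<sigma> (Suc i)")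
      case False
      moreover have "\<sigma> i \<noteq> \<sigma> (Suc i)"
        using inj_eq[OF permutes_inj[OF \<sigma>], of i "Suc i"] by simp
      ultimately have "\<sigma> \<circ> T \<in> S"
        using perm[OF \<sigma>] by (auto simp: S_def T_def)
      then show ?thesis
        using TT[of \<sigma>] by (metis UnI2 image_eqI)
    qed (use \<sigma> in \<open>simp add: S_def\<close>)
  qed (auto simp: S_def perm)
  moreover have "S \<inter> (\<lambda>\<sigma>. \<sigma> \<circ> T) ` S = {}"
    by (auto simp: S_def T_def)
  moreover have "finite S"
    by (rule finite_subset[OF _ finite_permutations[of "{..<m}"]]) (auto simp: S_def)
  moreover have "inj_on (\<lambda>\<sigma>. \<sigma> \<circ> T) S"
    by (rule inj_onI) (metis TT)
  ultimately have "row_minor q rs ls = (\<Sum>\<sigma>\<in>S. F \<sigma> + F (\<sigma> \<circ> T))"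
    by (simp add: row_minor_def F_def m_def sum.union_disjoint sum.reindex sum.distrib)
  moreover have "F \<sigma> + F (\<sigma> \<circ> T) \<in> q_ideal q" if "\<sigma> \<in> S" for \<sigma>
  proof -
    define a where "a = rs ! i"
    define \<gamma> where "\<gamma> = ls ! \<sigma> i"
    define \<delta> where "\<delta> = ls ! \<sigma> (Suc i)"
    define U :: "('r \<times> 'c, 'k) free_alg" where "U = prod_list (map (\<lambda>j. t (rs ! j) (ls ! \<sigma> j)) [0..<i])"
    define V :: "('r \<times> 'c, 'k) free_alg" where
      "V = prod_list (map (\<lambda>j. t (rs ! j) (ls ! \<sigma> j)) [Suc (Suc i)..<length rs])"
    have "\<sigma> (Suc i) < m"
      using that i(1) permutes_in_image[of \<sigma> "{..<m}" "Suc i"] by (simp add: S_def m_def)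
    then have "\<gamma> < \<delta>"
      using that ls i unfolding \<gamma>_def \<delta>_def
      by (intro sorted_wrt_nth_less[of "(<)"]) (auto simp: S_def m_def strict_sorted_iff)
    have 1: "minor_word rs ls \<sigma> = U * (t a \<gamma> * t a \<delta>) * V"
      using minor_word_split[OF i(1), of ls \<sigma>] i(2) by (simp add: U_def V_def a_def \<gamma>_def \<delta>_def)
    have "prod_list (map (\<lambda>j. t (rs ! j) (ls ! (\<sigma> \<circ> T) j)) [0..<i]) = U"
      "prod_list (map (\<lambda>j. t (rs ! j) (ls ! (\<sigma> \<circ> T) j)) [Suc (Suc i)..<length rs]) = V"
      unfolding U_def V_def
      by (rule arg_cong[of _ _ prod_list], rule map_cong, simp, simp add: T_def transpose_def)+
    then have 2: "minor_word rs ls (\<sigma> \<circ> T) = U * (t a \<delta> * t a \<gamma>) * V"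
      unfolding minor_word_split[OF i(1), of ls "\<sigma> \<circ> T"]
      using i(2) by (simp only: a_def \<gamma>_def \<delta>_def T_def comp_def transpose_apply_first transpose_apply_second)
    have 3: "inversions m (\<sigma> \<circ> T) = Suc (inversions m \<sigma>)"
      using that i(1) by (simp add: inversions_comp_transpose T_def S_def m_def)
    \<comment> \<open>The additional inversion of \<open>\<sigma> \<circ> T\<close> supplies the
      coefficient \<open>- q\<close> of the relator.\<close>
    have "F \<sigma> + F (\<sigma> \<circ> T) = scalar ((- q) ^ inversions m \<sigma>) *
        (U * (t a \<gamma> * t a \<delta> - scalar q * t a \<delta> * t a \<gamma>) * V)"
      by (simp add: F_def 1 2 3 scalar_minus scalar_simps algebra_simps
          scalar_left_commute[of U]
          scalar_left_commute[of "scalar ((- q) ^ inversions m \<sigma>)" q])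
    also have "\<dots> \<in> q_ideal q"
      using \<open>\<gamma> < \<delta>\<close> by (intro q_ideal_mult_left q_ideal_mult_right relator_row)
    finally show ?thesis .
  qed
  ultimately show ?thesis
    by (simp add: q_ideal_sum)
qed

section \<open>The operator on words, and on minors with a given list of rows\<close>

lemma row_scale_prod_list_gen:
  "free_hom (row_scale w) (prod_list (map gen ws)) =
     scalar (prod_list (map (w \<circ> fst) ws)) * prod_list (map gen ws)"
  by (induction ws)
    (auto simp: row_scale_def scalar_simps(2) scalar_normalize mult.assoc split: prod.splits)

lemma shift_deriv_prod_list_gen_eq_0:
  assumes "b \<notin> fst ` set ws"
  shows "shift_deriv q a b (prod_list (map gen ws)) = 0"
  using assms by (induction ws) (auto simp: shift_deriv_mult)

text \<open>Only the letter in row \<open>b\<close> can be hit. The letters before it survive the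
  cut unchanged since they avoid the interval; those after it contribute their weights.\<close>

lemma shift_deriv_prod_list_gen:
  fixes q :: "'k::field"
  assumes "b \<notin> fst ` set us" "b \<notin> fst ` set vs" "fst ` set us \<inter> between a b = {}"
  shows "shift_deriv q a b (prod_list (map gen (us @ (b, \<gamma>) # vs))) =
     scalar (prod_list (map (shift_weight q a b \<circ> fst) vs)) *
       prod_list (map gen (us @ (a, \<gamma>) # vs))"
proof -
  have "prod_list (map ((\<lambda>r. of_bool (r \<notin> between a b)) \<circ> fst) us) = (1 :: 'k)"
    using assms(3) by (induction us) auto
  then show ?thesis
    using assms(1,2)
    by (simp add: shift_deriv_mult shift_deriv_prod_list_gen_eq_0 row_scale_prod_list_gen
        scalar_simps(2) mult.assoc scalar_left_commute[of "prod_list (map gen us)"] scalar_normalize(2))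
qed

lemma minor_word_eq_zip:
  "minor_word rs ls \<sigma> = prod_list (map gen (zip rs (map (\<lambda>i. ls ! \<sigma> i) [0..<length rs])))"
  unfolding minor_word_def by (rule arg_cong[of _ _ prod_list], rule nth_equalityI) simp_all

lemma row_scale_row_minor:
  "free_hom (row_scale w) (row_minor q rs ls) = scalar (prod_list (map w rs)) * row_minor q rs ls"
proof -
  have "free_hom (row_scale w) (minor_word rs ls \<sigma>) = scalar (prod_list (map w rs)) * minor_word rs ls \<sigma>"
    for \<sigma>
    unfolding minor_word_eq_zip row_scale_prod_list_gen by (simp flip: map_map)
  then show ?thesis
    by (simp add: row_minor_def free_hom_sum sum_distrib_left scalar_normalize(3,4) mult.commute)
qed

lemma shift_deriv_row_minor_eq_0:
  assumes "b \<notin> set rs"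
  shows "shift_deriv q a b (row_minor q rs ls) = 0"
proof -
  have "shift_deriv q a b (minor_word rs ls \<sigma>) = 0" for \<sigma>
    unfolding minor_word_eq_zip
    by (rule shift_deriv_prod_list_gen_eq_0) (use assms in \<open>auto dest: set_zip_leftD\<close>)
  then show ?thesis
    by (simp add: row_minor_def shift_deriv_def twisted_deriv_sum)
qed

text \<open>The scalar depends only on the rows after \<open>b\<close>, hence is common to all
  permutations.\<close>

lemma shift_deriv_row_minor:
  assumes "b \<notin> set us" "b \<notin> set vs" "set us \<inter> between a b = {}"
  shows "shift_deriv q a b (row_minor q (us @ b # vs) ls) =
     scalar (prod_list (map (shift_weight q a b) vs)) * row_minor q (us @ a # vs) ls"
proof -
  have "shift_deriv q a b (minor_word (us @ b # vs) ls \<sigma>) =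
      scalar (prod_list (map (shift_weight q a b) vs)) * minor_word (us @ a # vs) ls \<sigma>" for \<sigma>
  proof -
    \<comment> \<open>The permuted columns do not depend on the rows, so one splitting serves both
      row lists.\<close>
    define cs where "cs = map (\<lambda>i. ls ! \<sigma> i) [0..<length us + Suc (length vs)]"
    define c where "c = cs ! length us"
    have cs: "cs = take (length us) cs @ c # drop (Suc (length us)) cs"
      unfolding c_def by (rule id_take_nth_drop) (simp add: cs_def)
    have zip: "zip (us @ r # vs) cs =
        zip us (take (length us) cs) @ (r, c) # zip vs (drop (Suc (length us)) cs)" for r
      by (subst cs) (simp add: cs_def)
    have "shift_deriv q a b (prod_list (map gen (zip (us @ b # vs) cs))) =
        scalar (prod_list (map (shift_weight q a b \<circ> fst) (zip vs (drop (Suc (length us)) cs)))) *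
        prod_list (map gen (zip (us @ a # vs) cs))"
      unfolding zip
      by (rule shift_deriv_prod_list_gen) (use assms in \<open>auto dest: set_zip_leftD\<close>)
    also have "map (shift_weight q a b \<circ> fst) (zip vs (drop (Suc (length us)) cs)) =
        map (shift_weight q a b) vs"
      by (simp add: cs_def flip: map_map)
    finally show ?thesis
      by (simp add: minor_word_eq_zip cs_def)
  qed
  then show ?thesis
    by (simp add: row_minor_def shift_deriv_def twisted_deriv_sum sum_distrib_left
        scalar_normalize(4) mult.commute)
qed


lemma sorted_list_of_set_insert_consecutive:
  assumes "finite K" "a \<in> K" "b \<in> K" "a < b" "K \<inter> {a<..<b} = {}"
  obtains us vs where "sorted_list_of_set K = us @ a # b # vs" "a \<notin> set us" "b \<notin> set us"
    "a \<notin> set vs" "b \<notin> set vs"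
proof -
  have sd: "sorted (sorted_list_of_set K)" "distinct (sorted_list_of_set K)"
    by simp_all
  obtain us ws where 1: "sorted_list_of_set K = us @ a # ws"
    using assms(1,2) by (metis set_sorted_list_of_set split_list)
  have "b \<in> set ws"
    using 1 sd assms by (metis (no_types) Un_iff leD list.set_intros(1) set_ConsD set_append set_sorted_list_of_set sorted_append less_irrefl)
  then obtain w vs where w: "ws = w # vs"
    by (cases ws) auto
  have "w \<in> K" "a < w" "w \<le> b"
    using 1 sd w assms(1) \<open>b \<in> set ws\<close> set_sorted_list_of_set[of K] by (auto simp: sorted_append)
  then have "w = b"
    using assms(5) by force
  then show ?thesis
    using that[of us vs] 1 w sd by auto
qed

lemma shift_deriv_q_minor_eq_0: "b \<notin> K \<Longrightarrow> shift_deriv q a b (q_minor q K L) = 0"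
  unfolding q_minor_eq_row_minor
  by (cases "finite K") (auto intro: shift_deriv_row_minor_eq_0)

text \<open>No row of \<open>K\<close> separates \<open>a\<close> from \<open>b\<close>, so
  \<open>a\<close> takes the place of \<open>b\<close> in the sorted list, and the rows after it all
  have weight 1.\<close>

lemma shift_deriv_q_minor:
  assumes "finite K" "b \<in> K" "a \<notin> K" "K \<inter> between a b = {}"
  shows "shift_deriv q a b (q_minor q K L) = q_minor q (insert a (K - {b})) L"
proof -
  have sd: "sorted (sorted_list_of_set K)" "distinct (sorted_list_of_set K)"
    by simp_all
  obtain us vs where 1: "sorted_list_of_set K = us @ b # vs"
    using assms(1,2) by (metis set_sorted_list_of_set split_list)
  have K: "K = insert b (set us \<union> set vs)"
    using 1 assms(1) set_sorted_list_of_set[of K] by auto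
  have b: "b \<notin> set us" "b \<notin> set vs"
    using sd unfolding 1 by auto
  have "sorted (us @ a # vs)"
    unfolding sorted_append
  proof (intro conjI)
    have neq: "x \<notin> between a b" "x \<noteq> a" "x \<noteq> b" if "x \<in> set us \<union> set vs" for x
      using that K b assms(3,4) by auto
    have "x \<le> a" if "x \<in> set us" for x
    proof -
      have "x < b"
        using sd(1) that neq[of x] unfolding 1 by (auto simp: sorted_append order.strict_iff_order)
      then show ?thesis
        using less_iff_less_not_between[of x a b] neq[of x] that by simp
    qed
    moreover have "a \<le> x" if "x \<in> set vs" for x
    proof -
      have "b < x"
        using sd(1) that neq[of x] unfolding 1 by (auto simp: sorted_append order.strict_iff_order)
      then show ?thesis
        using less_iff_less_not_between[of x a b] neq[of x] that by simp
    qed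
    ultimately show "sorted us" "sorted (a # vs)" "\<forall>x\<in>set us. \<forall>y\<in>set (a # vs). x \<le> y"
      using sd unfolding 1 by (auto simp: sorted_append)
  qed
  moreover have "distinct (us @ a # vs)" "set (us @ a # vs) = insert a (K - {b})"
    using sd b K assms(3) unfolding 1 by auto
  ultimately have 2: "sorted_list_of_set (insert a (K - {b})) = us @ a # vs"
    by (metis sorted_list_of_set.idem_if_sorted_distinct)
  have "map (shift_weight q a b) vs = map (\<lambda>_. 1) vs"
    using K b assms(3,4) by (auto simp: shift_weight_def)
  then have "prod_list (map (shift_weight q a b) vs) = 1"
    by (simp add: map_replicate_const)
  then show ?thesis
    unfolding q_minor_eq_row_minor 1 2
    using shift_deriv_row_minor[OF b, of a q] K assms(4) by (auto simp: scalar_simps(2))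
qed

text \<open>The rows \<open>a\<close> and \<open>b\<close> are neighbours in the sorted list of
  \<open>K\<close>, so the operator produces two equal adjacent rows.\<close>

lemma shift_deriv_q_minor_mem_q_ideal:
  assumes "finite K" "finite L" "card K = card L" "a \<in> K" "b \<in> K" "a \<noteq> b" "K \<inter> between a b = {}"
  shows "shift_deriv q a b (q_minor q K L) \<in> q_ideal q"
proof -
  note mem = row_minor_repeated_row[of "sorted_list_of_set L"]
  have len: "length (sorted_list_of_set L) = length (sorted_list_of_set K)"
    using assms(3) by simp
  show ?thesis
  proof (cases "a < b")
    case True
    have "K \<inter> {a<..<b} = {}"
      using assms(7) True by (simp add: between_def)
    then obtain us vs where 1: "sorted_list_of_set K = us @ a # b # vs"
      and 2: "a \<notin> set us" "b \<notin> set us" "a \<notin> set vs" "b \<notin> set vs"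
      using sorted_list_of_set_insert_consecutive assms True by metis
    \<comment> \<open>Here \<open>a\<close> precedes \<open>b\<close> and counts among the rows that
      must avoid the interval.\<close>
    have "set (us @ [a]) \<inter> between a b = {}"
      using assms(1,7) 1 set_sorted_list_of_set[of K] by auto
    then have "shift_deriv q a b (q_minor q K L) = scalar (prod_list (map (shift_weight q a b) vs)) *
        row_minor q (us @ a # a # vs) (sorted_list_of_set L)"
      using shift_deriv_row_minor[of b "us @ [a]" vs a q] 2 assms(6)
      by (simp add: q_minor_eq_row_minor 1)
    moreover have "row_minor q (us @ a # a # vs) (sorted_list_of_set L) \<in> q_ideal q"
      by (rule mem[where i = "length us"]) (use len in \<open>simp_all add: 1 nth_append\<close>)
    ultimately show ?thesis
      by (simp add: q_ideal_mult_left)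
  next
    case False
    have "K \<inter> {b<..<a} = {}" "b < a"
      using assms(6,7) False by (auto simp: between_def)
    then obtain us vs where 1: "sorted_list_of_set K = us @ b # a # vs"
      and 2: "a \<notin> set us" "b \<notin> set us" "a \<notin> set vs" "b \<notin> set vs"
      using sorted_list_of_set_insert_consecutive assms by metis
    have "set us \<inter> between a b = {}"
      using assms(1,7) 1 set_sorted_list_of_set[of K] by auto
    \<comment> \<open>Here \<open>a\<close> follows \<open>b\<close> and adds its own weight to the
      scalar.\<close>
    then have "shift_deriv q a b (q_minor q K L) = scalar (prod_list (map (shift_weight q a b) (a # vs))) *
        row_minor q (us @ a # a # vs) (sorted_list_of_set L)"
      using shift_deriv_row_minor[of b us "a # vs" a q] 2 assms(6)
      by (simp add: q_minor_eq_row_minor 1)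
    moreover have "row_minor q (us @ a # a # vs) (sorted_list_of_set L) \<in> q_ideal q"
      by (rule mem[where i = "length us"]) (use len in \<open>simp_all add: 1 nth_append\<close>)
    ultimately show ?thesis
      by (simp add: q_ideal_mult_left)
  qed
qed

lemma row_scale_q_minor:
  "free_hom (row_scale w) (q_minor q K L) = scalar (\<Prod>r\<in>K. w r) * q_minor q K L"
proof -
  have "prod_list (map w (sorted_list_of_set K)) = (\<Prod>r\<in>K. w r)"
    by (cases "finite K") (simp_all add: prod.distinct_set_conv_list[symmetric])
  then show ?thesis
    by (simp add: q_minor_eq_row_minor row_scale_row_minor)
qed

lemma q_minor_singleton [simp]: "q_minor q {k} {l} = t k l"
proof -
  have "{(i, j). i < j \<and> j < Suc 0 \<and> \<sigma> i > \<sigma> j} = {}" for \<sigma> :: "nat \<Rightarrow> nat"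
    by auto
  then have "inversions (Suc 0) \<sigma> = 0" for \<sigma>
    by (simp only: inversions_def card.empty)
  then show ?thesis
    by (simp add: q_minor_def lessThan_Suc scalar_simps(2))
qed


section \<open>Moving a row across several rows\<close>

text \<open>For \<open>q \<noteq> 0\<close>, a minor containing both rows has weight 1: this is
  where the powers of \<open>q\<close> cancel.\<close>

lemma prod_shift_weight:
  assumes "finite K" "K \<inter> between a b = {}" "a \<noteq> b"
  shows "(\<Prod>r\<in>K. shift_weight q a b r) =
    (if b \<in> K then shift_factor q a b else 1) * (if a \<in> K then inverse (shift_factor q a b) else 1)"
proof -
  have "(\<Prod>r\<in>K. shift_weight q a b r) =
      (\<Prod>r\<in>K. (if r = b then shift_factor q a b else 1) * (if r = a then inverse (shift_factor q a b) else 1))"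
    using assms by (intro prod.cong) (auto simp: shift_weight_def)
  also have "\<dots> = (if b \<in> K then shift_factor q a b else 1) * (if a \<in> K then inverse (shift_factor q a b) else 1)"
    using assms(1) by (simp add: prod.distrib)
  finally show ?thesis .
qed

lemma row_scale_t: "row_scale w (r, \<gamma>) = scalar (w r) * t r \<gamma>"
  by (simp add: row_scale_def)

text \<open>Factors are pairs of sets instead of \<open>symb\<close>, so that exchanging a row does
  not pass through the type definition.\<close>

definition minor_prod :: "'k::field \<Rightarrow> ('r::linorder set \<times> 'c::linorder set) list \<Rightarrow> ('r \<times> 'c, 'k) free_alg" where
  "minor_prod q ws = prod_list (map (\<lambda>(K, L). q_minor q K L) ws)"

lemma minor_prod_simps [simp]:
  "minor_prod q [] = 1"
  "minor_prod q ((K, L) # ws) = q_minor q K L * minor_prod q ws"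
  "minor_prod q (us @ ws) = minor_prod q us * minor_prod q ws"
  by (simp_all add: minor_prod_def)

lemma row_scale_minor_prod:
  "free_hom (row_scale w) (minor_prod q ws) = scalar (\<Prod>(K, L)\<leftarrow>ws. \<Prod>r\<in>K. w r) * minor_prod q ws"
proof (induction ws)
  case (Cons s ws)
  obtain K L where "s = (K, L)" by force
  then show ?case
    using Cons by (simp add: row_scale_q_minor scalar_simps(4) mult.assoc scalar_left_commute[of "q_minor q K L"])
qed (simp add: scalar_simps(2))

lemma row_scale_cut_minor_prod:
  fixes q :: "'k::field"
  assumes "\<And>K L. (K, L) \<in> set ws \<Longrightarrow> K \<inter> B = {}"
  shows "free_hom (row_scale (\<lambda>r. of_bool (r \<notin> B))) (minor_prod q ws) = minor_prod q ws"
proof -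
  have "(\<Prod>r\<in>K. of_bool (r \<notin> B)) = (1 :: 'k)" if "(K, L) \<in> set ws" for K L
    using assms[OF that] by (intro prod.neutral) auto
  then have "map (\<lambda>(K, L). \<Prod>r\<in>K. of_bool (r \<notin> B)) ws = map (\<lambda>_. 1 :: 'k) ws"
    by (intro map_cong) auto
  then show ?thesis
    by (simp add: row_scale_minor_prod map_replicate_const scalar_simps(2))
qed

text \<open>The Leibniz expansion has one term per factor. \<open>P\<close> is closed only under
  linear combinations, because it will also stand for "the remaining operators send \<open>x\<close>
  into the ideal"; the surrounding factors \<open>us\<close> and \<open>vs\<close> are therefore
  carried along.\<close>

lemma shift_deriv_minor_prod:
  assumes P: "P 0" "\<And>x y. P x \<Longrightarrow> P y \<Longrightarrow> P (x + y)" "\<And>c x. P x \<Longrightarrow> P (scalar c * x)"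
    and cut: "\<And>K L. (K, L) \<in> S \<Longrightarrow> K \<inter> between a b = {}"
    and "S \<subseteq> S'"
    and factor: "\<And>K L us vs. (K, L) \<in> S \<Longrightarrow> set us \<subseteq> S' \<Longrightarrow> set vs \<subseteq> S' \<Longrightarrow>
      P (minor_prod q us * shift_deriv q a b (q_minor q K L) * minor_prod q vs)"
    and "set us \<subseteq> S'" "set ws \<subseteq> S" "set vs \<subseteq> S'"
  shows "P (minor_prod q us * shift_deriv q a b (minor_prod q ws) * minor_prod q vs)"
  using assms(7,8)
proof (induction ws arbitrary: us)
  case Nil
  show ?case by (simp add: P)
next
  case (Cons s ws)
  obtain K L where s: "s = (K, L)" by force
  let ?c = "\<Prod>(K, L)\<leftarrow>ws. \<Prod>r\<in>K. shift_weight q a b r"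
  \<comment> \<open>The term hitting \<open>s\<close>: the later factors are only scaled and join
    \<open>vs\<close>.\<close>
  have 1: "P (scalar ?c * (minor_prod q us * shift_deriv q a b (q_minor q K L) * minor_prod q (ws @ vs)))"
    using Cons.prems assms(5,9) s by (intro P factor) auto
  \<comment> \<open>The terms missing \<open>s\<close>: the cut fixes it, and it joins
    \<open>us\<close>.\<close>
  have 2: "P (minor_prod q (us @ [s]) * shift_deriv q a b (minor_prod q ws) * minor_prod q vs)"
    using Cons.prems assms(5) by (intro Cons.IH) auto
  have "free_hom (row_scale (\<lambda>r. of_bool (r \<notin> between a b))) (q_minor q K L) = q_minor q K L"
  proof -
    have "K \<inter> between a b = {}"
      using cut Cons.prems s by auto
    then show ?thesis
      using row_scale_cut_minor_prod[of "[(K, L)]" "between a b" q] by simp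
  qed
  then have "minor_prod q us * shift_deriv q a b (minor_prod q (s # ws)) * minor_prod q vs =
      scalar ?c * (minor_prod q us * shift_deriv q a b (q_minor q K L) * minor_prod q (ws @ vs)) +
      minor_prod q (us @ [s]) * shift_deriv q a b (minor_prod q ws) * minor_prod q vs"
    by (simp add: s shift_deriv_mult row_scale_minor_prod distrib_left distrib_right mult.assoc
        scalar_left_commute[of "shift_deriv q a b (q_minor q K L)"] scalar_left_commute[of "minor_prod q us"])
  then show ?case
    using P(2)[OF 1 2] by simp
qed

text \<open>Separates the term hitting the linear factor from the rest \<open>x\<close>, in which a
  minor is hit.\<close>

lemma shift_deriv_minor_prod_generator:
  fixes q :: "'k::field" and A B :: "('r::linorder set \<times> 'c::linorder set) list"
  assumes P: "P 0" "\<And>x y. P x \<Longrightarrow> P y \<Longrightarrow> P (x + y)" "\<And>c x. P x \<Longrightarrow> P (scalar c * x)"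
    and cut: "\<And>K L. (K, L) \<in> S \<Longrightarrow> K \<inter> between a b = {}"
    and "S \<subseteq> S'"
    and factor: "\<And>K L us vs. (K, L) \<in> S \<Longrightarrow> set us \<subseteq> S' \<Longrightarrow> set vs \<subseteq> S' \<Longrightarrow>
      P (minor_prod q us * shift_deriv q a b (q_minor q K L) * minor_prod q vs)"
    and "set A \<subseteq> S" "set B \<subseteq> S" "({b}, {l}) \<in> S'"
  obtains x where "P x" "shift_deriv q a b (minor_prod q A * t b l * minor_prod q B) =
    scalar (\<Prod>(K, L)\<leftarrow>B. \<Prod>r\<in>K. shift_weight q a b r) * (minor_prod q A * t a l * minor_prod q B) + x"
proof -
  let ?c = "\<lambda>B. \<Prod>(K, L)\<leftarrow>B. \<Prod>r\<in>K. shift_weight q a b r"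
  \<comment> \<open>In the other terms the missed linear factor is treated as a minor of size
    1.\<close>
  let ?B' = "({b}, {l}) # B"
  have 1: "P (scalar (?c ?B') * (minor_prod q [] * shift_deriv q a b (minor_prod q A) * minor_prod q ?B'))"
    using assms by (intro P shift_deriv_minor_prod[of P S a b S']) auto
  have 2: "P (minor_prod q (A @ [({b}, {l})]) * shift_deriv q a b (minor_prod q B) * minor_prod q [])"
    using assms by (intro shift_deriv_minor_prod[of P S a b S']) auto
  have A: "free_hom (row_scale (\<lambda>r. of_bool (r \<notin> between a b))) (minor_prod q A) = minor_prod q A"
    by (rule row_scale_cut_minor_prod, rule cut) (use assms(7) in blast)
  have "shift_deriv q a b (minor_prod q A * minor_prod q ?B') =
      shift_deriv q a b (minor_prod q A) * (scalar (?c ?B') * minor_prod q ?B') +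
      minor_prod q A * (t a l * (scalar (?c B) * minor_prod q B) + t b l * shift_deriv q a b (minor_prod q B))"
    by (subst shift_deriv_mult, subst A)
      (simp add: shift_deriv_mult row_scale_minor_prod row_scale_t scalar_simps(2) scalar_normalize mult.assoc)
  also have "\<dots> = scalar (?c B) * (minor_prod q A * t a l * minor_prod q B) +
      (scalar (?c ?B') * (minor_prod q [] * shift_deriv q a b (minor_prod q A) * minor_prod q ?B') +
       minor_prod q (A @ [({b}, {l})]) * shift_deriv q a b (minor_prod q B) * minor_prod q [])"
    by (simp add: distrib_left mult.assoc scalar_normalize(2) scalar_left_commute[of "minor_prod q A"]
        scalar_left_commute[of "shift_deriv q a b (minor_prod q A)"])
  finally show ?thesis
    using that P(2)[OF 1 2] by (simp add: mult.assoc)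
qed


section \<open>The chain of rows between the two ends\<close>

lemma between_commute: "between a b = between b a"
  by (simp add: between_def min.commute max.commute)

lemma between_subset: "a \<in> between b c \<Longrightarrow> between a c \<subseteq> between b c"
  by (auto simp: between_def min_def max_def split: if_splits)

text \<open>Picks the first row of \<open>R\<close> met on the way from \<open>b\<close> to
  \<open>c\<close>, which is the target of the next operator.\<close>

lemma nearest_between:
  assumes "finite R" "R \<inter> between b c \<noteq> {}"
  obtains a where "a \<in> R" "a \<in> between b c" "R \<inter> between a b = {}"
proof (cases "b < c")
  case True
  let ?a = "Min (R \<inter> between b c)"
  have a: "?a \<in> R \<inter> between b c"
    using assms by (intro Min_in) auto
  have "r \<notin> between ?a b" if "r \<in> R" for r
  proof
    assume r: "r \<in> between ?a b"
    then have "r \<in> between b c" "r < ?a"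
      using a True by (auto simp: between_def)
    moreover from this have "?a \<le> r"
      using that assms(1) by (intro Min_le) auto
    ultimately show False
      by simp
  qed
  then show ?thesis
    using that[of ?a] a by blast
next
  case False
  let ?a = "Max (R \<inter> between b c)"
  have a: "?a \<in> R \<inter> between b c"
    using assms by (intro Max_in) auto
  have "r \<notin> between ?a b" if "r \<in> R" for r
  proof
    assume r: "r \<in> between ?a b"
    then have "r \<in> between b c" "?a < r"
      using a False by (auto simp: between_def)
    moreover from this have "r \<le> ?a"
      using that assms(1) by (intro Max_ge) auto
    ultimately show False
      by simp
  qed
  then show ?thesis
    using that[of ?a] a by blast
qed

text \<open>The factor depends only on the direction of the move, which is the same along the whole
  chain.\<close>

lemma shift_factor_between:
  assumes "a \<in> between b c"
  shows "shift_factor q a b = shift_factor q c b" "shift_factor q c a = shift_factor q c b"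
  using assms by (auto simp: between_def shift_factor_def min_def max_def split: if_splits)

lemma shift_factor_nonzero: "q \<noteq> 0 \<Longrightarrow> shift_factor q a b \<noteq> 0"
  by (simp add: shift_factor_def)

text \<open>
  Minors, paired with a linear factor \<open>t\<^sup>b\<^sub>l\<close> that is being moved to \<open>k'\<close>, from which the remaining
  operators cannot produce anything but zero. The second alternative is the linear factor when an
  operator has missed it.
\<close>

definition dead_minors :: "'r::linorder set \<Rightarrow> 'r \<Rightarrow> 'r \<Rightarrow> ('r set \<times> 'c set) set" where
  "dead_minors R b k' = {(K, L). finite K \<and> finite L \<and> card K = card L \<and> K \<subseteq> R \<and>
     (k' \<in> K \<or> K \<inter> ({b, k'} \<union> between b k') = {})}"

text \<open>The shape of the factors decorated by 0 in \<open>f\<close>, before any operator has hit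
  them.\<close>

definition minors_containing :: "'r set \<Rightarrow> 'r \<Rightarrow> ('r set \<times> 'c set) set" where
  "minors_containing R k' = {(K, L). finite K \<and> finite L \<and> card K = card L \<and> K \<subseteq> R \<and> k' \<in> K}"

lemma minors_containing_subset_dead_minors: "minors_containing R k' \<subseteq> dead_minors R b k'"
  by (auto simp: minors_containing_def dead_minors_def)

lemma dead_minors_mono: "a \<in> between b k' \<Longrightarrow> dead_minors R b k' \<subseteq> dead_minors R a k'"
  using between_subset[of a b k'] by (fastforce simp: dead_minors_def)

text \<open>A hit minor vanishes if it lacks \<open>b\<close> or contains both rows; otherwise it
  still contains \<open>k'\<close>, and so stays dead for the next operator.\<close>

lemma shift_deriv_dead_minor:
  assumes "(K, L) \<in> dead_minors R b k'" "a \<noteq> b" "b \<noteq> k'" "R \<inter> between a b = {}" "a \<in> R"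
  shows "shift_deriv q a b (q_minor q K L) \<in> q_ideal q \<or> a \<noteq> k' \<and>
    (insert a (K - {b}), L) \<in> dead_minors R a k' \<and>
    shift_deriv q a b (q_minor q K L) = q_minor q (insert a (K - {b})) L"
proof -
  have K: "finite K" "finite L" "card K = card L" "K \<subseteq> R" "K \<inter> between a b = {}"
    using assms(1,4) by (auto simp: dead_minors_def)
  consider "b \<notin> K" | "b \<in> K" "a \<in> K" | "b \<in> K" "a \<notin> K"
    by blast
  then show ?thesis
  proof cases
    case 1
    then show ?thesis by (simp add: shift_deriv_q_minor_eq_0)
  next
    case 2
    then show ?thesis using K assms(2) by (simp add: shift_deriv_q_minor_mem_q_ideal)
  next
    case 3
    \<comment> \<open>The other alternative of \<open>dead_minors\<close> excludes \<open>b\<close>.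
      Since \<open>a\<close> is not in \<open>K\<close>, also \<open>a \<noteq> k'\<close>.\<close>
    then have "k' \<in> K"
      using assms(1) by (auto simp: dead_minors_def)
    moreover have "card (insert a (K - {b})) = card K"
      using 3 K(1) by (simp add: card.insert_remove card.remove[symmetric] card_Diff_singleton)
        (metis Suc_pred card_gt_0_iff empty_iff)
    ultimately show ?thesis
      using 3 K assms(3,5) by (auto simp: dead_minors_def shift_deriv_q_minor)
  qed
qed

text \<open>The induction invariant for the composite of all operators from \<open>b\<close> on to
  \<open>k'\<close>. Intermediate rows may be missing in the minors of \<open>B\<close>, so the
  scalar has to be recorded; it is 1 once all of them contain \<open>b\<close>.\<close>

definition row_transfer :: "'k::field \<Rightarrow> 'r::linorder set \<Rightarrow> 'r \<Rightarrow> 'r \<Rightarrow>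
    (('r \<times> 'c::linorder, 'k) free_alg \<Rightarrow> ('r \<times> 'c, 'k) free_alg) \<Rightarrow> bool" where
  "row_transfer q R b k' \<Phi> \<longleftrightarrow>
     (\<forall>x y. \<Phi> (x + y) = \<Phi> x + \<Phi> y) \<and> (\<forall>c x. \<Phi> (scalar c * x) = scalar c * \<Phi> x) \<and>
     (\<forall>x\<in>q_ideal q. \<Phi> x \<in> q_ideal q) \<and>
     (\<forall>ws. set ws \<subseteq> dead_minors R b k' \<longrightarrow> \<Phi> (minor_prod q ws) \<in> q_ideal q) \<and>
     (\<forall>A B l. set A \<subseteq> minors_containing R k' \<longrightarrow> set B \<subseteq> minors_containing R k' \<longrightarrow>
        \<Phi> (minor_prod q A * t b l * minor_prod q B) -
        scalar (\<Prod>(K, L)\<leftarrow>B. if b \<in> K then 1 else inverse (shift_factor q k' b)) *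
          (minor_prod q A * t k' l * minor_prod q B) \<in> q_ideal q)"

lemma row_transferD:
  assumes "row_transfer q R b k' \<Phi>"
  shows "\<Phi> (x + y) = \<Phi> x + \<Phi> y" "\<Phi> (scalar c * x) = scalar c * \<Phi> x"
    "x \<in> q_ideal q \<Longrightarrow> \<Phi> x \<in> q_ideal q"
    "set ws \<subseteq> dead_minors R b k' \<Longrightarrow> \<Phi> (minor_prod q ws) \<in> q_ideal q"
    "set A \<subseteq> minors_containing R k' \<Longrightarrow> set B \<subseteq> minors_containing R k' \<Longrightarrow>
        \<Phi> (minor_prod q A * t b l * minor_prod q B) -
        scalar (\<Prod>(K, L)\<leftarrow>B. if b \<in> K then 1 else inverse (shift_factor q k' b)) *
          (minor_prod q A * t k' l * minor_prod q B) \<in> q_ideal q"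
  using assms unfolding row_transfer_def by blast+

lemma prod_list_map_mult:
  fixes f g :: "'a \<Rightarrow> 'b::comm_monoid_mult"
  shows "(\<Prod>x\<leftarrow>xs. f x * g x) = (\<Prod>x\<leftarrow>xs. f x) * (\<Prod>x\<leftarrow>xs. g x)"
  by (induction xs) (simp_all add: ac_simps)

text \<open>With target \<open>k'\<close>, \<open>shift_deriv_dead_minor\<close> leaves only the
  vanishing alternative, so only the term hitting the linear factor survives.\<close>

lemma row_transfer_adjacent:
  fixes q :: "'k::field" and b k' :: "'r::linorder"
  assumes "q \<noteq> 0" "b \<noteq> k'" "k' \<in> R" "R \<inter> between k' b = {}"
  shows "row_transfer q R b k' (shift_deriv q k' b :: ('r \<times> 'c::linorder, 'k) free_alg \<Rightarrow> _)"
proof -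
  define S :: "('r set \<times> 'c set) set" where "S = dead_minors R b k'"
  have cut: "K \<inter> between k' b = {}" if "(K, L) \<in> S" for K L
    using that assms(4) by (auto simp: S_def dead_minors_def)
  have factor: "shift_deriv q k' b (q_minor q K L) \<in> q_ideal q" if "(K, L) \<in> S" for K L
    using shift_deriv_dead_minor[of K L R b k' k' q] that assms by (auto simp: S_def)
  have dead: "shift_deriv q k' b (minor_prod q ws) \<in> q_ideal q" if "set ws \<subseteq> S" for ws
    using shift_deriv_minor_prod[of "\<lambda>x. x \<in> q_ideal q" S k' b UNIV q "[]" ws "[]"] cut factor that
    by (simp add: q_ideal_add q_ideal_mult_left q_ideal_mult_right)
  have main: "shift_deriv q k' b (minor_prod q A * t b l * minor_prod q B) -
        scalar (\<Prod>(K, L)\<leftarrow>B. if b \<in> K then 1 else inverse (shift_factor q k' b)) *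
          (minor_prod q A * t k' l * minor_prod q B) \<in> q_ideal q"
    if A: "set A \<subseteq> minors_containing R k'" and B: "set B \<subseteq> minors_containing R k'"
    for A B :: "('r set \<times> 'c set) list" and l
  proof -
    have "set A \<subseteq> S" "set B \<subseteq> S"
      using A B minors_containing_subset_dead_minors unfolding S_def by blast+
    then obtain x where x: "x \<in> q_ideal q" "shift_deriv q k' b (minor_prod q A * t b l * minor_prod q B) =
        scalar (\<Prod>(K, L)\<leftarrow>B. \<Prod>r\<in>K. shift_weight q k' b r) * (minor_prod q A * t k' l * minor_prod q B) + x"
      using shift_deriv_minor_prod_generator[of "\<lambda>x. x \<in> q_ideal q" S k' b UNIV q A B l] cut factor
      by (auto simp: q_ideal_add q_ideal_mult_left q_ideal_mult_right)
    have "(\<Prod>r\<in>K. shift_weight q k' b r) = (if b \<in> K then 1 else inverse (shift_factor q k' b))"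
      if "(K, L) \<in> set B" for K L
      using that B cut[of K L] assms(1,2) \<open>set B \<subseteq> S\<close>
      by (subst prod_shift_weight) (auto simp: minors_containing_def shift_factor_nonzero)
    then have eq: "map (\<lambda>(K, L). \<Prod>r\<in>K. shift_weight q k' b r) B =
        map (\<lambda>(K, L). if b \<in> K then 1 else inverse (shift_factor q k' b)) B"
      by (intro map_cong) auto
    show ?thesis
      unfolding x(2) eq using x(1) by simp
  qed
  have "shift_deriv q k' b x \<in> q_ideal q" if "x \<in> q_ideal q" for x :: "('r \<times> 'c, 'k) free_alg"
    using that assms(1,2) by (intro shift_deriv_q_ideal) auto
  then show ?thesis
    unfolding row_transfer_def using dead main by (simp add: S_def)
qed

text \<open>First \<open>b\<close> moves to its neighbour \<open>a\<close>, then
  \<open>\<Phi>\<close> moves \<open>a\<close> on to \<open>k'\<close>. Every term missing the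
  linear factor is a product of minors that are dead for \<open>\<Phi>\<close>, or already lies in
  the ideal.\<close>

lemma row_transfer_comp:
  fixes q :: "'k::field" and a b k' :: "'r::linorder"
    and \<Phi> :: "('r \<times> 'c::linorder, 'k) free_alg \<Rightarrow> ('r \<times> 'c, 'k) free_alg"
  assumes "q \<noteq> 0" "b \<noteq> k'" "a \<in> R" "b \<in> R" "a \<in> between b k'" "R \<inter> between a b = {}"
    and \<Phi>: "row_transfer q R a k' \<Phi>"
  shows "row_transfer q R b k' (\<Phi> \<circ> shift_deriv q a b)"
proof -
  define S :: "('r set \<times> 'c set) set" where "S = dead_minors R b k'"
  define S' :: "('r set \<times> 'c set) set" where "S' = dead_minors R a k'"
  note \<Phi> = row_transferD[OF \<Phi>]
  define P where "P x \<longleftrightarrow> \<Phi> x \<in> q_ideal q" for x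
  have ab: "a \<noteq> b" "a \<noteq> k'"
    using assms(5) by auto
  have P: "P 0" "\<And>x y. P x \<Longrightarrow> P y \<Longrightarrow> P (x + y)" "\<And>c x. P x \<Longrightarrow> P (scalar c * x)"
    by (simp_all add: P_def \<Phi> q_ideal_add q_ideal_mult_left)
  have cut: "K \<inter> between a b = {}" if "(K, L) \<in> S" for K L
    using that assms(6) by (auto simp: S_def dead_minors_def)
  have sub: "S \<subseteq> S'"
    unfolding S_def S'_def by (rule dead_minors_mono[OF assms(5)])
  have factor: "P (minor_prod q us * shift_deriv q a b (q_minor q K L) * minor_prod q vs)"
    if KL: "(K, L) \<in> S" and "set us \<subseteq> S'" "set vs \<subseteq> S'" for K L us vs
  proof -
    consider "shift_deriv q a b (q_minor q K L) \<in> q_ideal q"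
      | "(insert a (K - {b}), L) \<in> S'"
        "shift_deriv q a b (q_minor q K L) = q_minor q (insert a (K - {b})) L"
      using shift_deriv_dead_minor[OF KL[unfolded S_def] ab(1) assms(2,6,3), of q]
      unfolding S'_def by blast
    then show ?thesis
    proof cases
      case 1
      then show ?thesis
        by (simp add: P_def \<Phi>(3) q_ideal_mult_left q_ideal_mult_right)
    next
      case 2
      then show ?thesis
        using \<Phi>(4)[of "us @ (insert a (K - {b}), L) # vs"] that(2,3)
        by (simp add: P_def S'_def mult.assoc)
    qed
  qed
  have dead: "P (shift_deriv q a b (minor_prod q ws))" if "set ws \<subseteq> S" for ws
    using shift_deriv_minor_prod[of P S a b S' q "[]" ws "[]"] cut factor sub P that
    by simp
  have main: "\<Phi> (shift_deriv q a b (minor_prod q A * t b l * minor_prod q B)) -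
        scalar (\<Prod>(K, L)\<leftarrow>B. if b \<in> K then 1 else inverse (shift_factor q k' b)) *
          (minor_prod q A * t k' l * minor_prod q B) \<in> q_ideal q"
    if A: "set A \<subseteq> minors_containing R k'" and B: "set B \<subseteq> minors_containing R k'" for A B l
  proof -
    let ?M = "minor_prod q A * t a l * minor_prod q B"
    let ?N = "minor_prod q A * t k' l * minor_prod q B"
    define c where "c = (\<Prod>(K, L)\<leftarrow>B. \<Prod>r\<in>K. shift_weight q a b r)"
    define d where "d = (\<Prod>(K, L)\<leftarrow>B. if a \<in> K then 1 else inverse (shift_factor q k' a))"
    have AB: "set A \<subseteq> S" "set B \<subseteq> S"
      using A B minors_containing_subset_dead_minors unfolding S_def by blast+
    have "b \<notin> between a k'"
      using assms(5) by (auto simp: between_def min_def max_def split: if_splits)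
    \<comment> \<open>A linear factor left behind in row \<open>b\<close> is out of reach of the
      remaining operators.\<close>
    then have "({b}, {l}) \<in> S'"
      using assms(2,4) ab by (simp add: S'_def dead_minors_def)
    then obtain x where x: "P x" "shift_deriv q a b (minor_prod q A * t b l * minor_prod q B) = scalar c * ?M + x"
      unfolding c_def
      using shift_deriv_minor_prod_generator[of P S a b S' q A B l] P cut sub factor AB by blast
    \<comment> \<open>All shift factors here coincide, so the dependence on whether \<open>a\<close>
      is in \<open>K\<close> drops out.\<close>
    have "(\<Prod>r\<in>K. shift_weight q a b r) * (if a \<in> K then 1 else inverse (shift_factor q k' a)) =
        (if b \<in> K then 1 else inverse (shift_factor q k' b))"
      if "(K, L) \<in> set B" for K L
      using that B cut[of K L] assms(1) ab AB(2) shift_factor_between[OF assms(5), of q]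
      by (subst prod_shift_weight) (auto simp: minors_containing_def shift_factor_nonzero)
    then have "c * d = (\<Prod>(K, L)\<leftarrow>B. if b \<in> K then 1 else inverse (shift_factor q k' b))"
      unfolding c_def d_def prod_list_map_mult[symmetric]
      by (intro arg_cong[of _ _ prod_list] map_cong) auto
    moreover have "scalar c * (\<Phi> ?M - scalar d * ?N) + \<Phi> x \<in> q_ideal q"
      using \<Phi>(5)[OF A B, of l] x(1) by (intro q_ideal_add q_ideal_mult_left) (simp_all add: d_def P_def)
    moreover have "\<Phi> (shift_deriv q a b (minor_prod q A * t b l * minor_prod q B)) - scalar (c * d) * ?N =
        scalar c * (\<Phi> ?M - scalar d * ?N) + \<Phi> x"
      unfolding x(2) \<Phi>(1,2) by (simp add: right_diff_distrib scalar_normalize(4))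
    ultimately show ?thesis
      by simp
  qed
  have "shift_deriv q a b x \<in> q_ideal q" if "x \<in> q_ideal q" for x :: "('r \<times> 'c, 'k) free_alg"
    using that assms(1) ab(1) by (intro shift_deriv_q_ideal)
  then show ?thesis
    unfolding row_transfer_def using dead main by (simp add: S_def P_def \<Phi>(1,2,3))
qed

text \<open>Induction on the number of rows of \<open>R\<close> strictly between \<open>b\<close>
  and \<open>k'\<close>, passing to the row nearest to \<open>b\<close>.\<close>

lemma row_transfer_exists:
  assumes "q \<noteq> 0" "finite R" "b \<in> R" "k' \<in> R" "b \<noteq> k'"
  shows "\<exists>\<Phi> :: ('r::linorder \<times> 'c::linorder, 'k::field) free_alg \<Rightarrow> _. row_transfer q R b k' \<Phi>"
  using assms(3,5)
proof (induction "card (R \<inter> between b k')" arbitrary: b rule: less_induct)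
  case less
  show ?case
  proof (cases "R \<inter> between b k' = {}")
    case True
    then show ?thesis
      using row_transfer_adjacent[of q b k' R] less.prems assms by (auto simp: between_commute)
  next
    case False
    then obtain a where a: "a \<in> R" "a \<in> between b k'" "R \<inter> between a b = {}"
      using nearest_between assms(2) by metis
    have "R \<inter> between a k' \<subset> R \<inter> between b k'"
      using a between_subset[OF a(2)] not_between(1)[of a k'] by blast
    then have "card (R \<inter> between a k') < card (R \<inter> between b k')"
      using assms(2) by (intro psubset_card_mono) auto
    moreover have "a \<noteq> k'"
      using a(2) by auto
    ultimately obtain \<Phi> :: "('r \<times> 'c, 'k) free_alg \<Rightarrow> _" where "row_transfer q R a k' \<Phi>"
      using less.hyps a(1) by blast
    then show ?thesis
      using row_transfer_comp[of q b k' a R \<Phi>] a less.prems assms by blast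
  qed
qed


section \<open>The replacement rule\<close>

text \<open>A lift to the free algebra of the composite of \<open>pi_N\<close> and
  \<open>pi_M q\<close>.\<close>

definition minor_hom :: "'k::field \<Rightarrow> (('r::linorder, 'c::linorder) dsymb, 'k) free_alg \<Rightarrow> ('r \<times> 'c, 'k) free_alg" where
  "minor_hom q f = free_hom (\<lambda>s. q_minor q (rows s) (cols s)) (pi_N f)"

lemma decorated_identity_iff_minor_hom: "decorated_identity q f \<longleftrightarrow> minor_hom q f \<in> q_ideal q"
  by (simp add: decorated_identity_iff minor_hom_def)

lemma minor_hom_free_hom:
  "minor_hom q (free_hom g f) =
     (\<Sum>w\<in>Poly_Mapping.keys f. scalar (Poly_Mapping.lookup f w) * minor_hom q (prod_list (map g w)))"
  by (simp add: minor_hom_def pi_N_def free_hom_def[of g f] free_hom_sum)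

lemma minor_hom_gens:
  "minor_hom q (prod_list (map gen w)) = minor_prod q (map (\<lambda>(s, i). (rows s, cols s)) w)"
  by (induction w) (auto simp: minor_hom_def pi_N_def minor_prod_def split: prod.splits)

lemma free_hom_gen_id: "free_hom gen f = f"
  by (induction f rule: free_alg_induct) simp_all

lemma linearity_split:
  assumes "linearity k l\<^sub>0 f" "w \<in> Poly_Mapping.keys f"
  obtains l u v where "w = u @ fsym k l 1 # v" "\<forall>x\<in>set u \<union> set v. snd x = 0"
proof -
  obtain l where l: "count_list w (fsym k l 1) = 1" "\<forall>x\<in>set w. x \<noteq> fsym k l 1 \<longrightarrow> snd x = 0"
    using assms unfolding linearity_def by blast
  then have "fsym k l 1 \<in> set w"
    by (metis count_list_0_iff zero_neq_one)
  then obtain u v where w: "w = u @ fsym k l 1 # v"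
    by (auto dest: split_list)
  then have "fsym k l 1 \<notin> set u \<union> set v"
    using l(1) by (simp add: count_list_0_iff)
  then have "\<forall>x\<in>set u \<union> set v. snd x = 0"
    using w l(2) by (metis UnE Un_iff list.set_intros(2) set_append)
  then show ?thesis
    using that w by blast
qed

lemma rows_cols_fsym [simp]:
  "rows (fst (fsym k l i)) = {k}" "cols (fst (fsym k l i)) = {l}" "snd (fsym k l i) = i"
  by (simp_all add: fsym_def rows_cols_Delta)

lemma linearity_imp_injective_match:
  assumes "linearity k l\<^sub>0 f"
  shows "injective_match k f"
  unfolding injective_match_def
proof
  fix w assume "w \<in> Poly_Mapping.keys f"
  then obtain l where l: "count_list w (fsym k l 1) = 1" "\<forall>x\<in>set w. x \<noteq> fsym k l 1 \<longrightarrow> snd x = 0"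
    using assms unfolding linearity_def by blast
  then have "fsym k l 1 \<in> set w"
    by (metis count_list_0_iff zero_neq_one)
  then have "{y \<in> set w. snd y = 1 \<and> k \<in> rows (fst y)} = {fsym k l 1}"
    using l(2) by fastforce
  with l(1) show "\<exists>x. {y \<in> set w. snd y = 1 \<and> k \<in> rows (fst y)} = {x} \<and> count_list w x = 1"
    by blast
qed

theorem mainTheorem1:
  fixes q :: "'k::field"
    and f :: "(('r::{linorder,countable}, 'c::{linorder,countable}) dsymb, 'k) free_alg"
    and k k' :: 'r and l\<^sub>0 :: 'c
  assumes "q \<noteq> 0"
    and "k \<noteq> k'"
    and "decorated_identity q f"
    and "linearity k l\<^sub>0 f"
    and "included_row k k' l\<^sub>0 f"
    and "decorated_identity q (erase_hom k' l\<^sub>0 f)"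
  shows "injective_match k f \<and> decorated_identity q (replace_hom k k' f)"
proof
  show "injective_match k f"
    using assms(4) by (rule linearity_imp_injective_match)
next
  \<comment> \<open>Restricting to the finitely many rows of \<open>f\<close> makes the chain finite
    even for infinitely many labels; \<open>k'\<close> itself need not occur in
    \<open>f\<close>.\<close>
  define R where "R = {k, k'} \<union> (\<Union>w\<in>Poly_Mapping.keys f. \<Union>x\<in>set w. rows (fst x))"
  define rep where "rep = (\<lambda>(s :: ('r, 'c) symb, i :: nat).
     if i = 1 \<and> k \<in> rows s \<and> k' \<notin> rows s
     then gen (Delta (rows s - {k} \<union> {k'}) (cols s), 1)
     else gen (s, i) :: (('r, 'c) dsymb, 'k) free_alg)"
  have "finite R"
    by (auto simp: R_def rows_cols)
  then obtain \<Phi> :: "('r \<times> 'c, 'k) free_alg \<Rightarrow> _" where "row_transfer q R k k' \<Phi>"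
    using row_transfer_exists[of q R k k'] assms(1,2) by (auto simp: R_def)
  note \<Phi> = row_transferD[OF this]
  have word: "\<Phi> (minor_hom q (prod_list (map gen w))) - minor_hom q (prod_list (map rep w)) \<in> q_ideal q"
    if w: "w \<in> Poly_Mapping.keys f" for w
  proof -
    obtain l u v where uv: "w = u @ fsym k l 1 # v" "\<forall>x\<in>set u \<union> set v. snd x = 0"
      using linearity_split[OF assms(4) w] .
    define A where "A = map (\<lambda>(s, i). (rows s, cols s)) u"
    define B where "B = map (\<lambda>(s, i). (rows s, cols s)) v"
    have kk': "k \<in> rows (fst x)" "k' \<in> rows (fst x)" "rows (fst x) \<subseteq> R"
      if "x \<in> set u \<union> set v" for x
      using that uv w assms(5) unfolding included_row_def R_def by auto
    have AB: "set A \<subseteq> minors_containing R k'" "set B \<subseteq> minors_containing R k'"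
      using kk' rows_cols by (fastforce simp: A_def B_def minors_containing_def)+
    \<comment> \<open>By the included row condition every minor contains \<open>k\<close>, so the
      scalar is 1 in every monomial.\<close>
    have "map (\<lambda>(K, L). if k \<in> K then 1 else inverse (shift_factor q k' k)) B = map (\<lambda>_. 1) B"
      using kk' by (fastforce simp: B_def)
    then have one: "(\<Prod>(K, L)\<leftarrow>B. if k \<in> K then 1 else inverse (shift_factor q k' k)) = 1"
      by (simp only: map_replicate_const prod_list_replicate power_one)
    have "rep x = gen x" if "x \<in> set u \<union> set v" for x
      using bspec[OF uv(2) that] by (cases x) (simp add: rep_def)
    then have "map rep u = map gen u" "map rep v = map gen v"
      by simp_all
    moreover have "rep (fsym k l 1) = gen (fsym k' l 1)"
      using assms(2) by (simp add: rep_def fsym_def rows_cols_Delta)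
    ultimately have "map rep w = map gen (u @ fsym k' l 1 # v)"
      by (simp add: uv(1))
    then have "minor_hom q (prod_list (map rep w)) = minor_prod q A * t k' l * minor_prod q B"
      by (simp only: minor_hom_gens) (simp add: A_def B_def case_prod_unfold mult.assoc)
    moreover have "minor_hom q (prod_list (map gen w)) = minor_prod q A * t k l * minor_prod q B"
      unfolding uv(1) minor_hom_gens by (simp add: A_def B_def case_prod_unfold mult.assoc)
    ultimately show ?thesis
      using \<Phi>(5)[OF AB, of l] by (simp add: one scalar_simps(2))
  qed
  \<comment> \<open>Scaling by 0 gives \<open>\<Phi> 0 = 0\<close>, as needed for empty and infinite
    \<open>S\<close>.\<close>
  have sum: "\<Phi> (\<Sum>w\<in>S. g w) = (\<Sum>w\<in>S. \<Phi> (g w))" for S and g :: "('r, 'c) dsymb list \<Rightarrow> _"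
    using \<Phi>(2)[of 0 0] by (induction S rule: infinite_finite_induct) (simp_all add: \<Phi>(1) scalar_simps(1))
  have f: "minor_hom q f = (\<Sum>w\<in>Poly_Mapping.keys f.
      scalar (Poly_Mapping.lookup f w) * minor_hom q (prod_list (map gen w)))"
    using minor_hom_free_hom[of q gen f] by (simp add: free_hom_gen_id)
  \<comment> \<open>On \<open>f\<close>, the operator \<open>\<Phi>\<close> realizes the replacement
    rule modulo the ideal, which it also preserves.\<close>
  have "\<Phi> (minor_hom q f) - minor_hom q (replace_hom k k' f) = (\<Sum>w\<in>Poly_Mapping.keys f.
      scalar (Poly_Mapping.lookup f w) *
      (\<Phi> (minor_hom q (prod_list (map gen w))) - minor_hom q (prod_list (map rep w))))"
    unfolding f sum \<Phi>(2) replace_hom_def rep_def[symmetric] minor_hom_free_hom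
    by (simp add: right_diff_distrib sum_subtractf)
  also have "\<dots> \<in> q_ideal q"
    by (intro q_ideal_sum q_ideal_mult_left word)
  finally have "\<Phi> (minor_hom q f) - minor_hom q (replace_hom k k' f) \<in> q_ideal q" .
  moreover have "\<Phi> (minor_hom q f) \<in> q_ideal q"
    using assms(3) \<Phi>(3) by (simp add: decorated_identity_iff_minor_hom)
  ultimately have "\<Phi> (minor_hom q f) - (\<Phi> (minor_hom q f) - minor_hom q (replace_hom k k' f)) \<in> q_ideal q"
    using q_ideal_diff by blast
  then show "decorated_identity q (replace_hom k k' f)"
    by (simp add: decorated_identity_iff_minor_hom)
qed

end
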